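(* For every $i\in\mathbb N$, the set of measures $\{\widehat{\nu}_p^{(i)} : p\in(\tfrac12,1)\}$ is, after normalizing each measure to a probability measure, the set of all ergodic probability tail invariant measures on $X_B$.
   Context: Let $B$ be the one-sided stationary generalized Bratteli diagram with levels $V_n$, $n\ge 0$, each a copy of $\mathbb N=\{1,2,3,\dots\}$, and with exactly one edge from vertex $j\in V_n$ to vertex $j\in V_{n+1}$ (vertical) and exactly one edge from vertex $j\in V_n$ to vertex $j+1\in V_{n+1}$ (diagonal), and no other edges, for all $n\ge0$, $j\in\mathbb N$. $X_B$ is the set of infinite paths starting at a vertex of $V_0$, with the (Polish, zero-dimensional) topology generated by cylinder sets (all infinite paths with a given finite initial path). "Measure" means a non-atomic positive Borel measure. Two paths $(x_n),(y_n)$ in $X_B$ are tail equivalent if $x_n=y_n$ for all sufficiently large $n$; this is the tail equivalence relation $\mathcal R$. A measure $\mu$ on $X_B$ is tail invariant if $\mu([\overline e])=\mu([\overline e'])$ for any two finite paths $\overline e,\overline e'$ starting at $V_0$ and ending at the same vertex of the same level. Ergodic means ergodic with respect to $\mathcal R$. For $i\in\mathbb N$, $B_i$ is the vertex subdiagram of $B$ with vertices $W_n=\{i,\dots,i+n\}\subset V_n$ and all edges of $B$ between them; its path space $X_i$ is the set of paths in $X_B$ starting at vertex $i$ of $V_0$. $B_i$ is a copy of the Pascal diagram. For $0<p<1$, $\nu_p^{(i)}$ is the tail invariant probability measure on $X_i$ giving a cylinder set the product of the weights of its edges, each vertical edge having weight $p$ and each diagonal edge having weight $1-p$. The extension $\widehat\nu_p^{(i)}$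 of $\nu_p^{(i)}$ to $X_B$ is the (possibly infinite) tail invariant measure on $X_B$ obtained by extending by tail invariance to the saturation $\mathcal R(X_i)$ (the set of all paths tail equivalent to a path in $X_i$) and setting it equal to $0$ on the complement: for every finite path $\overline e'$ in $B$ starting at $V_0$ and ending at a vertex $w\in W_n$ of level $n$, the set of paths that begin with $\overline e'$ and then continue inside $B_i$ has $\widehat\nu_p^{(i)}$-measure equal to $\nu_p^{(i)}([\overline e])$, where $\overline e$ is any finite path in $B_i$ from $i\in V_0$ to $w$; and $\widehat\nu_p^{(i)}(X_B\setminus\mathcal R(X_i))=0$. *)

theory Defs
  imports "HOL-Probability.Probability"
begin

text \<open>
  Every level $V_n$ is a copy of the positive integers. Two vertices of consecutive levels are
  joined by at most one edge, so an edge is the pair (source, range). The diagram is stationary,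
  so the level of an edge is not recorded in the edge: it is its position in the path.
\<close>

type_synonym edge = "nat \<times> nat"

definition edges :: "edge set" where
  "edges = {(j, k). 1 \<le> j \<and> (k = j \<or> k = j + 1)}"

definition path_space :: "(nat \<Rightarrow> edge) set" where
  "path_space = {x. \<forall>n. x n \<in> edges \<and> snd (x n) = fst (x (Suc n))}"

text \<open>
  \<open>finite_path v es w\<close>: the edge list \<open>es\<close> is a path from \<open>v \<in> V\<^sub>0\<close> to \<open>w\<close> at level \<open>length es\<close>.
  The start vertex is kept explicitly because of the paths of length 0.
\<close>

fun finite_path :: "nat \<Rightarrow> edge list \<Rightarrow> nat \<Rightarrow> bool" where
  "finite_path v [] w \<longleftrightarrow> 1 \<le> v \<and> v = w"
| "finite_path v (e # es) w \<longleftrightarrow> e \<in> edges \<and> fst e = v \<and> finite_path (snd e) es w"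

definition cylinder :: "nat \<Rightarrow> edge list \<Rightarrow> (nat \<Rightarrow> edge) set" where
  "cylinder v es = {x \<in> path_space. fst (x 0) = v \<and> (\<forall>k < length es. x k = es ! k)}"

definition path_topology :: "(nat \<Rightarrow> edge) topology" where
  "path_topology = topology_generated_by {cylinder v es | v es w. finite_path v es w}"

text \<open>Only the measurable space matters here, as \<open>sigma\<close> carries the zero measure.\<close>

definition path_borel :: "(nat \<Rightarrow> edge) measure" where
  "path_borel = sigma path_space {U. openin path_topology U}"

definition tail_rel :: "((nat \<Rightarrow> edge) \<times> (nat \<Rightarrow> edge)) set" where
  "tail_rel = {(x, y). x \<in> path_space \<and> y \<in> path_space \<and> (\<exists>N. \<forall>n\<ge>N. x n = y n)}"

definition nonatomic :: "'a measure \<Rightarrow> bool" where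
  "nonatomic M \<longleftrightarrow> (\<forall>A \<in> sets M. 0 < emeasure M A \<longrightarrow>
     (\<exists>B \<in> sets M. B \<subseteq> A \<and> 0 < emeasure M B \<and> emeasure M B < emeasure M A))"

definition tail_invariant :: "(nat \<Rightarrow> edge) measure \<Rightarrow> bool" where
  "tail_invariant M \<longleftrightarrow> (\<forall>v es v' es' w.
     finite_path v es w \<and> finite_path v' es' w \<and> length es = length es' \<longrightarrow>
     emeasure M (cylinder v es) = emeasure M (cylinder v' es'))"

definition tail_ergodic :: "(nat \<Rightarrow> edge) measure \<Rightarrow> bool" where
  "tail_ergodic M \<longleftrightarrow> (\<forall>A \<in> sets M. tail_rel `` A = A \<longrightarrow>
     emeasure M A = 0 \<or> emeasure M (space M - A) = 0)"

definition ergodic_invariant_probs :: "(nat \<Rightarrow> edge) measure set" where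
  "ergodic_invariant_probs = {M. sets M = sets path_borel \<and> prob_space M \<and> nonatomic M \<and>
     tail_invariant M \<and> tail_ergodic M}"

definition sub_vertices :: "nat \<Rightarrow> nat \<Rightarrow> nat set" where
  "sub_vertices i n = {i..i + n}"

definition sub_edges :: "nat \<Rightarrow> nat \<Rightarrow> edge set" where
  "sub_edges i n = {(j, k) \<in> edges. j \<in> sub_vertices i n \<and> k \<in> sub_vertices i (Suc n)}"

definition sub_finite_path :: "nat \<Rightarrow> edge list \<Rightarrow> nat \<Rightarrow> bool" where
  "sub_finite_path i es w \<longleftrightarrow> finite_path i es w \<and> (\<forall>k < length es. es ! k \<in> sub_edges i k)"

definition sub_path_space :: "nat \<Rightarrow> (nat \<Rightarrow> edge) set" where
  "sub_path_space i = {x \<in> path_space. fst (x 0) = i}"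

definition edge_weight :: "real \<Rightarrow> edge \<Rightarrow> real" where
  "edge_weight p e = (if snd e = fst e then p else 1 - p)"

text \<open>
  The values on the cylinder sets determine the measure. Its tail invariance on the subdiagram is
  automatic, since the number of diagonal edges of a path from \<open>i\<close> to \<open>w\<close> is \<open>w - i\<close>.
\<close>

definition nu :: "nat \<Rightarrow> real \<Rightarrow> (nat \<Rightarrow> edge) measure" where
  "nu i p = (THE M. sets M = sets (restrict_space path_borel (sub_path_space i)) \<and> prob_space M \<and>
     (\<forall>es w. sub_finite_path i es w \<longrightarrow>
        emeasure M (cylinder i es) = ennreal (prod_list (map (edge_weight p) es))))"

text \<open>
  \<open>tail_rel `` sub_path_space i\<close> is the saturation. It is the countable union of the sets
  prescribed in the last but one clause, which form an intersection-stable system up to the empty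
  set; the last two clauses thus determine the measure.
\<close>

definition nu_hat :: "nat \<Rightarrow> real \<Rightarrow> (nat \<Rightarrow> edge) measure" where
  "nu_hat i p = (THE M. sets M = sets path_borel \<and> tail_invariant M \<and>
     (\<forall>v es' w es. finite_path v es' w \<and> w \<in> sub_vertices i (length es') \<and>
        sub_finite_path i es w \<and> length es = length es' \<longrightarrow>
        emeasure M {x \<in> cylinder v es'. \<forall>m \<ge> length es'. x m \<in> sub_edges i m} =
          emeasure (nu i p) (cylinder i es)) \<and>
     emeasure M (path_space - tail_rel `` sub_path_space i) = 0)"

text \<open>
  The result is a probability measure exactly if the total mass is neither 0 nor \<open>\<infinity>\<close>;
  in the other cases it is the zero measure.
\<close>

definition normalized :: "'a measure \<Rightarrow> 'a measure" where
  "normalized M = scale_measure (inverse (emeasure M (space M))) M"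

end

theory Submission
  imports Defs
begin

text \<open>
  A path is a start vertex together with a sequence of steps, each vertical or diagonal. Put
  \<open>\<lambda> = (1 - p) / p\<close>. A path of \<open>B\<^sub>i\<close> that ends at vertex \<open>w\<close> of level \<open>n\<close> has \<open>w - i\<close> diagonal edges,
  hence \<open>\<nu>\<^sub>p\<close>-mass \<open>p ^ n * \<lambda> ^ (w - i)\<close>. Tail invariance transports this mass to every path of
  the whole diagram with the same end, and the measure that results gives start vertex \<open>s\<close> the
  weight \<open>\<lambda>\<close> to the power \<open>s - i\<close> and lets the steps be independent. It is finite exactly if
  \<open>\<lambda> < 1\<close>, that is \<open>p > 1/2\<close>, and normalizing it gives a geometric start vertex followed by
  Bernoulli steps, whatever \<open>i\<close> is: \<open>normalized_nu_hat\<close>. So the claim is that the measures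
  \<open>geometric_bernoulli p\<close> with \<open>1/2 < p < 1\<close> are exactly the nonatomic ergodic tail invariant
  probability measures.

  They are ergodic because of a Liouville property. For an invariant set \<open>A\<close>, the conditional
  probability of \<open>A\<close> given a cylinder depends only on the end of the cylinder, and as a function of
  level and vertex it is bounded and harmonic for the random walk with step probabilities \<open>p\<close> and
  \<open>1 - p\<close>. Such functions are constant (\<open>bounded_harmonic_constant\<close>), so \<open>A\<close> is independent of
  all cylinders, hence of itself. Ergodicity also shows that the saturation of the paths starting
  at \<open>i\<close>, which has positive measure, has full measure.

  Conversely let \<open>M\<close> be ergodic, and let \<open>f n w\<close> be the mass of a cylinder ending at \<open>w\<close> on level
  \<open>n\<close>. Then \<open>f n w = f (n + 1) w + f (n + 1) (w + 1)\<close>, and this says that \<open>M\<close> is preserved by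
  the map \<open>drop_step\<close> that deletes the first step of a path and keeps its start vertex. Restricting
  \<open>M\<close> to the paths whose first step is vertical and then deleting that step therefore gives a
  measure below \<open>M\<close>. It is tail invariant, with cylinder masses \<open>f (n + 1) w\<close>. An ergodic measure
  dominates only multiples of itself among the tail invariant ones
  (\<open>ergodic_dominated_proportional\<close>), so \<open>f (n + 1) w = c * f n w\<close> for a constant \<open>c\<close>. With the
  recursion for \<open>f\<close> this leaves \<open>f n w\<close> proportional to \<open>c ^ n * ((1 - c) / c) ^ w\<close>. A finite total
  mass needs \<open>c > 1/2\<close>, and nonatomicity excludes \<open>c = 1\<close>, which is the point mass on the vertical
  path at vertex 1.
\<close>

section \<open>Finite paths and cylinder sets\<close>

lemma finite_path_range_ge1: "finite_path v es w \<Longrightarrow> 1 \<le> w"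
  by (induction v es w rule: finite_path.induct) auto

lemma finite_path_source_ge1: "finite_path v es w \<Longrightarrow> 1 \<le> v"
  by (cases es) (auto simp: edges_def)

lemma finite_path_append:
  "finite_path v (es @ gs) w \<longleftrightarrow> (\<exists>u. finite_path v es u \<and> finite_path u gs w)"
  by (induction es arbitrary: v) (auto dest: finite_path_source_ge1)

lemma finite_path_snoc:
  "finite_path v (es @ [e]) w' \<longleftrightarrow> finite_path v es (fst e) \<and> e \<in> edges \<and> w' = snd e"
  by (auto simp: finite_path_append edges_def)

lemma finite_path_range_unique: "finite_path v es w \<Longrightarrow> finite_path v es w' \<Longrightarrow> w = w'"
  by (induction v es w rule: finite_path.induct) auto

lemma finite_path_vertical: "1 \<le> w \<Longrightarrow> finite_path w (replicate n (w, w)) w"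
  by (induction n) (auto simp: edges_def)

lemma finite_path_initial_segment:
  assumes "x \<in> path_space"
  shows "finite_path (fst (x 0)) (map x [0..<n]) (fst (x n))"
proof (induction n)
  case 0
  have "x 0 \<in> edges"
    using assms by (simp add: path_space_def)
  then show ?case
    by (auto simp: edges_def)
next
  case (Suc n)
  have "x n \<in> edges" "snd (x n) = fst (x (Suc n))" "x (Suc n) \<in> edges"
    using assms by (simp_all add: path_space_def)
  with Suc show ?case
    by (simp add: finite_path_snoc)
qed

lemma cylinder_iff_initial_segment:
  "x \<in> cylinder v es \<longleftrightarrow> x \<in> path_space \<and> fst (x 0) = v \<and> map x [0..<length es] = es"
  unfolding cylinder_def list_eq_iff_nth_eq by simp

lemma cylinder_subset_path_space: "cylinder v es \<subseteq> path_space"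
  by (auto simp: cylinder_def)

lemma mem_cylinder_initial_segment:
  "x \<in> path_space \<Longrightarrow> x \<in> cylinder (fst (x 0)) (map x [0..<n])"
  by (simp add: cylinder_iff_initial_segment)

lemma cylinder_endpoint:
  assumes "x \<in> cylinder v es" "finite_path v es w"
  shows "fst (x (length es)) = w"
  using assms finite_path_initial_segment[of x "length es"] finite_path_range_unique
  by (auto simp: cylinder_iff_initial_segment)

lemma cylinder_append:
  "x \<in> cylinder v (es @ gs) \<longleftrightarrow> x \<in> cylinder v es \<and> (\<forall>k < length gs. x (length es + k) = gs ! k)"
  by (auto simp: cylinder_def nth_append)
     (metis add_diff_inverse_nat add_less_cancel_left)

text \<open>
  Two cylinders that meet are nested, because they prescribe edges of a common path.
\<close>

lemma cylinder_append_cases: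
  assumes "x \<in> cylinder u gs" "x \<in> cylinder v es" "length es \<le> length gs"
  obtains hs where "gs = es @ hs" "u = v"
proof
  have "take (length es) gs = es"
    using assms by (intro nth_equalityI) (auto simp: cylinder_def)
  then show "gs = es @ drop (length es) gs"
    by (metis append_take_drop_id)
  show "u = v"
    using assms by (auto simp: cylinder_def)
qed

lemma cylinder_split:
  assumes "finite_path v es w"
  shows "cylinder v es = cylinder v (es @ [(w, w)]) \<union> cylinder v (es @ [(w, Suc w)])"
proof -
  have "x (length es) = (w, w) \<or> x (length es) = (w, Suc w)" if "x \<in> cylinder v es" for x
  proof -
    have "x (length es) \<in> edges"
      using that by (auto simp: cylinder_def path_space_def)
    with cylinder_endpoint[OF that assms] show ?thesis
      by (cases "x (length es)") (auto simp: edges_def)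
  qed
  then show ?thesis
    by (fastforce simp: cylinder_append)
qed

lemma cylinder_split_disjoint:
  "cylinder v (es @ [(w, w)]) \<inter> cylinder v (es @ [(w, Suc w)]) = {}"
  by (auto simp: cylinder_append)

section \<open>Cylinders and the Borel sets\<close>

text \<open>
  The bound on the length makes it possible to test measurability, or an equality of measures, on
  cylinders so long that they decide what happens up to level \<open>n\<close>.
\<close>

definition cylinders_from :: "nat \<Rightarrow> (nat \<Rightarrow> edge) set set" where
  "cylinders_from n = {cylinder v es | v es w. finite_path v es w \<and> n \<le> length es}"

lemma cylinders_from_iff:
  "C \<in> cylinders_from n \<longleftrightarrow> (\<exists>v es w. C = cylinder v es \<and> finite_path v es w \<and> n \<le> length es)"
  by (auto simp: cylinders_from_def)

lemma countable_cylinders_from: "countable (cylinders_from n)"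
proof -
  have "cylinders_from n \<subseteq> (\<lambda>(v, es). cylinder v es) ` UNIV"
    by (auto simp: cylinders_from_def)
  then show ?thesis
    by (rule countable_subset) simp
qed

lemma Int_stable_cylinders_from: "Int_stable (insert {} (cylinders_from n))"
proof (rule Int_stableI)
  fix A B assume AB: "A \<in> insert {} (cylinders_from n)" "B \<in> insert {} (cylinders_from n)"
  have *: "cylinder u gs \<inter> cylinder v es \<in> {{}, cylinder u gs}"
    if "length es \<le> length gs" for u gs v es
  proof (cases "cylinder u gs \<inter> cylinder v es = {}")
    case False
    then obtain x where "x \<in> cylinder u gs" "x \<in> cylinder v es"
      by blast
    from cylinder_append_cases[OF this that] obtain hs where "gs = es @ hs" "u = v"
      by blast
    then have "cylinder u gs \<subseteq> cylinder v es"
      using cylinder_append by blast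
    then show ?thesis
      by blast
  qed simp
  show "A \<inter> B \<in> insert {} (cylinders_from n)"
  proof (cases "A = {} \<or> B = {}")
    case False
    with AB obtain u gs v es where "A = cylinder u gs" "B = cylinder v es"
      by (auto simp: cylinders_from_def)
    with *[of es gs u v] *[of gs es v u] have "A \<inter> B \<in> {{}, A, B}"
      by (cases "length es \<le> length gs") (auto simp: Int_commute)
    with AB show ?thesis
      by auto
  qed auto
qed

text \<open>
  The cylinders around a path shrink to it. Asking for all \<open>m\<close> beyond a bound, instead of a single
  one, lets the bounds for two open sets be combined.
\<close>

lemma openin_path_topology_locally:
  assumes "openin path_topology U" "x \<in> U"
  shows "x \<in> path_space \<and> (\<exists>n. \<forall>m\<ge>n. cylinder (fst (x 0)) (map x [0..<m]) \<subseteq> U)"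
proof -
  have "generate_topology_on {cylinder v es | v es w. finite_path v es w} U"
    using assms by (simp add: path_topology_def openin_topology_generated_by_iff)
  then show ?thesis
    using \<open>x \<in> U\<close>
  proof induction
    case (Int a b)
    then obtain k l where "\<forall>m\<ge>k. cylinder (fst (x 0)) (map x [0..<m]) \<subseteq> a"
        "\<forall>m\<ge>l. cylinder (fst (x 0)) (map x [0..<m]) \<subseteq> b"
      by auto
    then have "\<forall>m\<ge>max k l. cylinder (fst (x 0)) (map x [0..<m]) \<subseteq> a \<inter> b"
      by auto
    then show ?case
      using Int by blast
  next
    case (UN K)
    then obtain k where "k \<in> K" "x \<in> k"
      by blast
    with UN(2)[of k] show ?case
      by blast
  next
    case (Basis s)
    then obtain v es w where s: "s = cylinder v es" "x \<in> cylinder v es"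
      by blast
    have "cylinder (fst (x 0)) (map x [0..<m]) \<subseteq> s" if "m \<ge> length es" for m
      using that s by (auto simp: cylinder_def)
    with s show ?case
      by (auto simp: cylinder_def)
  qed simp
qed

lemma openin_path_topology_subset: "openin path_topology U \<Longrightarrow> U \<subseteq> path_space"
  using openin_path_topology_locally by blast

lemma space_path_borel [simp]: "space path_borel = path_space"
  unfolding path_borel_def using openin_path_topology_subset
  by (simp add: space_measure_of_conv)

lemma cylinders_from_cover: "path_space = \<Union> (cylinders_from n)"
proof -
  have "x \<in> \<Union> (cylinders_from n)" if "x \<in> path_space" for x
    using mem_cylinder_initial_segment[OF that, of n] finite_path_initial_segment[OF that, of n]
    by (fastforce simp: cylinders_from_iff)
  then show ?thesis
    using cylinder_subset_path_space by (fastforce simp: cylinders_from_iff)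
qed

text \<open>
  There are only countably many cylinders, so every open set is a countable union of those inside it.
\<close>

lemma sets_path_borel: "sets path_borel = sigma_sets path_space (cylinders_from n)"
proof -
  have "sets path_borel = sigma_sets path_space {U. openin path_topology U}"
    unfolding path_borel_def using openin_path_topology_subset
    by (simp add: sets_measure_of subset_eq)
  moreover have "sigma_sets path_space {U. openin path_topology U}
      = sigma_sets path_space (cylinders_from n)"
  proof (rule sigma_sets_eqI)
    fix U assume "U \<in> {U. openin path_topology U}"
    then have U: "openin path_topology U"
      by simp
    have "U = \<Union> {C \<in> cylinders_from n. C \<subseteq> U}"
    proof
      show "U \<subseteq> \<Union> {C \<in> cylinders_from n. C \<subseteq> U}"
      proof
        fix x assume "x \<in> U"
        from openin_path_topology_locally[OF U this] obtain k where
          x: "x \<in> path_space" and k: "\<forall>m\<ge>k. cylinder (fst (x 0)) (map x [0..<m]) \<subseteq> U"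
          by blast
        let ?C = "cylinder (fst (x 0)) (map x [0..<max k n])"
        have "?C \<in> cylinders_from n"
          using finite_path_initial_segment[OF x, of "max k n"]
          by (fastforce simp: cylinders_from_iff)
        moreover have "?C \<subseteq> U"
          using k by simp
        ultimately show "x \<in> \<Union> {C \<in> cylinders_from n. C \<subseteq> U}"
          using mem_cylinder_initial_segment[OF x, of "max k n"] by blast
      qed
    qed blast
    moreover have "\<Union> {C \<in> cylinders_from n. C \<subseteq> U} \<in> sigma_sets path_space (cylinders_from n)"
      using countable_cylinders_from[of n]
      by (intro sigma_sets_UNION) (auto intro: countable_subset)
    ultimately show "U \<in> sigma_sets path_space (cylinders_from n)"
      by simp
  next
    fix C assume "C \<in> cylinders_from n"
    then have "openin path_topology C"
      unfolding path_topology_def cylinders_from_def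
      by (intro topology_generated_by_Basis) auto
    then show "C \<in> sigma_sets path_space {U. openin path_topology U}"
      by auto
  qed
  ultimately show ?thesis
    by simp
qed

lemma cylinder_in_sets:
  assumes "finite_path v es w"
  shows "cylinder v es \<in> sets path_borel"
  unfolding sets_path_borel[of 0] using assms
  by (intro sigma_sets.Basic) (auto simp: cylinders_from_iff)

lemma measurable_path_borelI:
  assumes "\<And>x. x \<in> space N \<Longrightarrow> f x \<in> path_space"
    and "\<And>v es w. finite_path v es w \<Longrightarrow> n \<le> length es \<Longrightarrow> f -` cylinder v es \<inter> space N \<in> sets N"
  shows "f \<in> measurable N path_borel"
proof (rule measurable_sigma_sets)
  show "sets path_borel = sigma_sets path_space (cylinders_from n)"
    by (rule sets_path_borel)
  show "cylinders_from n \<subseteq> Pow path_space"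
    using cylinders_from_cover by blast
  show "f \<in> space N \<rightarrow> path_space"
    using assms(1) by blast
  show "f -` C \<inter> space N \<in> sets N" if "C \<in> cylinders_from n" for C
    using that assms(2) unfolding cylinders_from_iff by blast
qed

text \<open>
  Long cylinders form an intersection-stable generator, up to the empty set, and countably many of
  them cover the space.
\<close>

lemma path_measure_eqI:
  assumes M: "sets M = sets path_borel" and N: "sets N = sets path_borel"
    and eq: "\<And>v es w. finite_path v es w \<Longrightarrow> n \<le> length es \<Longrightarrow>
      emeasure M (cylinder v es) = emeasure N (cylinder v es)"
    and fin: "\<And>v es w. finite_path v es w \<Longrightarrow> n \<le> length es \<Longrightarrow> emeasure M (cylinder v es) \<noteq> \<infinity>"
  shows "M = N"
proof (rule measure_eqI_generator_eq_countable[where A = "cylinders_from n" and \<Omega> = path_space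
      and E = "insert {} (cylinders_from n)"])
  have gen: "sigma_sets path_space (insert {} (cylinders_from n)) = sets path_borel"
    unfolding sets_path_borel[of n]
    by (rule sigma_sets_eqI) (auto intro: sigma_sets.Empty)
  show "Int_stable (insert {} (cylinders_from n))"
    by (rule Int_stable_cylinders_from)
  show "insert {} (cylinders_from n) \<subseteq> Pow path_space"
    using cylinders_from_cover by blast
  show "sets M = sigma_sets path_space (insert {} (cylinders_from n))"
    "sets N = sigma_sets path_space (insert {} (cylinders_from n))"
    using M N gen by simp_all
  show "\<Union> (cylinders_from n) = path_space"
    using cylinders_from_cover by simp
  show "emeasure M C = emeasure N C" if "C \<in> insert {} (cylinders_from n)" for C
    using that eq unfolding insert_iff cylinders_from_iff by auto
  show "emeasure M C \<noteq> \<infinity>" if "C \<in> cylinders_from n" for C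
    using that fin unfolding cylinders_from_iff by auto
qed (auto simp: countable_cylinders_from)

section \<open>Exchanging initial segments\<close>

lemma cylinder_Int_shorter:
  assumes "length es \<le> length gs"
  shows "cylinder u gs \<inter> cylinder v es
    = (if u = v \<and> take (length es) gs = es then cylinder u gs else {})"
proof (cases "u = v \<and> take (length es) gs = es")
  case True
  then have "gs = es @ drop (length es) gs"
    by (metis append_take_drop_id)
  then have "cylinder u gs \<subseteq> cylinder v es"
    using True cylinder_append by (metis subsetI)
  with True show ?thesis
    by auto
next
  case False
  have "x \<notin> cylinder v es" if x: "x \<in> cylinder u gs" for x
  proof
    assume "x \<in> cylinder v es"
    from cylinder_append_cases[OF x this assms] False show False
      by (metis append_eq_conv_conj)
  qed
  with False show ?thesis
    by auto
qed

lemma finite_path_nth: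
  "finite_path v es w \<Longrightarrow> k < length es \<Longrightarrow>
    es ! k \<in> edges \<and> snd (es ! k) = (if Suc k < length es then fst (es ! Suc k) else w)"
proof (induction v es w arbitrary: k rule: finite_path.induct)
  case (2 v e es w)
  then show ?case
    by (cases k; cases es) auto
qed simp

lemma finite_path_nth_0: "finite_path v es w \<Longrightarrow> es \<noteq> [] \<Longrightarrow> fst (es ! 0) = v"
  by (cases es) auto

definition same_endpoint :: "nat \<Rightarrow> edge list \<Rightarrow> nat \<Rightarrow> edge list \<Rightarrow> bool" where
  "same_endpoint v es v' es' \<longleftrightarrow>
    length es = length es' \<and> (\<exists>w. finite_path v es w \<and> finite_path v' es' w)"

lemma same_endpoint_sym: "same_endpoint v es v' es' \<Longrightarrow> same_endpoint v' es' v es"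
  by (auto simp: same_endpoint_def)

definition replace_prefix :: "edge list \<Rightarrow> (nat \<Rightarrow> edge) \<Rightarrow> nat \<Rightarrow> edge" where
  "replace_prefix es x = (\<lambda>k. if k < length es then es ! k else x k)"

text \<open>
  The exchange is possible because both segments arrive at the same vertex of the same level.
\<close>

lemma replace_prefix_in_cylinder:
  assumes same: "same_endpoint v es v' es'" and x: "x \<in> cylinder v es"
  shows "replace_prefix es' x \<in> cylinder v' es'"
proof -
  obtain w where w: "finite_path v es w" "finite_path v' es' w" and len: "length es = length es'"
    using same by (auto simp: same_endpoint_def)
  have end_x: "fst (x (length es')) = w"
    using cylinder_endpoint[OF x w(1)] len by simp
  have px: "x n \<in> edges" "snd (x n) = fst (x (Suc n))" for n
    using x by (auto simp: cylinder_def path_space_def)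
  have "replace_prefix es' x n \<in> edges \<and>
      snd (replace_prefix es' x n) = fst (replace_prefix es' x (Suc n))" for n
  proof (cases "n < length es'")
    case True
    then have "Suc n < length es' \<or> Suc n = length es'"
      by auto
    then show ?thesis
      using finite_path_nth[OF w(2) True] True end_x by (auto simp: replace_prefix_def)
  next
    case False
    then show ?thesis
      using px[of n] by (simp add: replace_prefix_def)
  qed
  moreover have "fst (replace_prefix es' x 0) = v'"
  proof (cases "es' = []")
    case True
    with w len end_x show ?thesis
      by (simp add: replace_prefix_def)
  next
    case False
    with finite_path_nth_0[OF w(2)] show ?thesis
      by (simp add: replace_prefix_def)
  qed
  ultimately show ?thesis
    by (simp add: cylinder_def path_space_def replace_prefix_def)
qed

lemma replace_prefix_inverse:
  assumes "x \<in> cylinder v es" "length es = length es'"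
  shows "replace_prefix es (replace_prefix es' x) = x"
  using assms by (auto simp: replace_prefix_def cylinder_def)

text \<open>
  The preimage of a cylinder that is at least as long as the exchanged segment is again a cylinder
  with the same end, or empty. This is what carries tail invariance over to Borel sets.
\<close>

lemma replace_prefix_preimage:
  assumes same: "same_endpoint v es v' es'" and len: "length es \<le> length gs"
  shows "{x \<in> cylinder v es. replace_prefix es' x \<in> cylinder u gs}
    = (if u = v' \<and> take (length es) gs = es' then cylinder v (es @ drop (length es) gs) else {})"
proof -
  have l: "length es' = length es"
    using same by (simp add: same_endpoint_def)
  have "replace_prefix es' x \<in> cylinder u gs \<longleftrightarrow> u = v' \<and> take (length es) gs = es' \<and>
      x \<in> cylinder v (es @ drop (length es) gs)" if x: "x \<in> cylinder v es" for x
  proof -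
    have in': "replace_prefix es' x \<in> cylinder v' es'"
      by (rule replace_prefix_in_cylinder[OF same x])
    have "replace_prefix es' x \<in> cylinder u gs \<longleftrightarrow> u = v' \<and> take (length es) gs = es' \<and>
        replace_prefix es' x \<in> cylinder u gs"
      using cylinder_Int_shorter[of es' gs u v'] in' len l by (auto split: if_splits)
    also have "\<dots> \<longleftrightarrow> u = v' \<and> take (length es) gs = es' \<and>
        replace_prefix es' x \<in> cylinder v' (es' @ drop (length es) gs)"
      by (metis append_take_drop_id)
    also have "\<dots> \<longleftrightarrow> u = v' \<and> take (length es) gs = es' \<and>
        x \<in> cylinder v (es @ drop (length es) gs)"
      using in' x l by (auto simp: cylinder_append replace_prefix_def)
    finally show ?thesis .
  qed
  moreover have "cylinder v (es @ drop (length es) gs) \<subseteq> cylinder v es"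
    using cylinder_append by blast
  ultimately show ?thesis
    by auto
qed

lemma finite_path_replace_prefix:
  assumes "same_endpoint v es v' es'" "finite_path v' gs z" "take (length es) gs = es'"
  shows "finite_path v (es @ drop (length es) gs) z"
proof -
  have "finite_path v' (es' @ drop (length es) gs) z"
    using assms(2,3) by (metis append_take_drop_id)
  then show ?thesis
    using assms(1) finite_path_range_unique
    by (fastforce simp: finite_path_append same_endpoint_def)
qed

lemma path_measure_space: "sets M = sets path_borel \<Longrightarrow> space M = path_space"
  using sets_eq_imp_space_eq[of M path_borel] by simp

lemma cylinder_in_path_measure:
  "sets M = sets path_borel \<Longrightarrow> finite_path v es w \<Longrightarrow> cylinder v es \<in> sets M"
  using cylinder_in_sets by simp

lemma space_restrict_cylinder:
  "sets M = sets path_borel \<Longrightarrow> space (restrict_space M (cylinder v es)) = cylinder v es"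
  using cylinder_subset_path_space[of v es]
  by (simp add: space_restrict_space path_measure_space Int_absorb2)

lemma sets_restrict_cylinder_iff:
  assumes "sets M = sets path_borel" "finite_path v es w"
  shows "A \<in> sets (restrict_space M (cylinder v es)) \<longleftrightarrow> A \<subseteq> cylinder v es \<and> A \<in> sets M"
  by (rule sets_restrict_space_iff) (intro sets.Int sets.top cylinder_in_path_measure[OF assms])

lemma measurable_replace_prefix:
  assumes same: "same_endpoint v es v' es'" and M: "sets M = sets path_borel"
  shows "replace_prefix es' \<in> measurable (restrict_space M (cylinder v es)) path_borel"
proof (rule measurable_path_borelI[where n = "length es"])
  obtain w where w: "finite_path v es w"
    using same by (auto simp: same_endpoint_def)
  note space = space_restrict_cylinder[OF M, of v es]
  show "replace_prefix es' x \<in> path_space" if "x \<in> space (restrict_space M (cylinder v es))" for x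
    using replace_prefix_in_cylinder[OF same, of x] that cylinder_subset_path_space
    unfolding space by blast
  fix u gs z assume gs: "finite_path u gs z" "length es \<le> length gs"
  have eq: "replace_prefix es' -` cylinder u gs \<inter> cylinder v es
      = {x \<in> cylinder v es. replace_prefix es' x \<in> cylinder u gs}"
    by blast
  have "cylinder v (es @ drop (length es) gs) \<in> sets M" if "u = v' \<and> take (length es) gs = es'"
    using finite_path_replace_prefix[OF same, of gs z] that gs(1)
    by (intro cylinder_in_path_measure[OF M]) blast
  then have "{x \<in> cylinder v es. replace_prefix es' x \<in> cylinder u gs} \<in> sets M"
    unfolding replace_prefix_preimage[OF same gs(2)] by simp
  then show "replace_prefix es' -` cylinder u gs \<inter> space (restrict_space M (cylinder v es))
      \<in> sets (restrict_space M (cylinder v es))"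
    unfolding space eq sets_restrict_cylinder_iff[OF M w] by blast
qed

lemma replace_prefix_preimage_in_sets:
  assumes same: "same_endpoint v es v' es'" and M: "sets M = sets path_borel" and B: "B \<in> sets M"
  shows "{x \<in> cylinder v es. replace_prefix es' x \<in> B} \<in> sets M"
proof -
  obtain w where w: "finite_path v es w"
    using same by (auto simp: same_endpoint_def)
  have "replace_prefix es' -` B \<inter> cylinder v es \<in> sets M"
    using measurable_sets[OF measurable_replace_prefix[OF same M], of B] B
    unfolding space_restrict_cylinder[OF M] sets_restrict_cylinder_iff[OF M w] M by blast
  moreover have "replace_prefix es' -` B \<inter> cylinder v es = {x \<in> cylinder v es. replace_prefix es' x \<in> B}"
    by blast
  ultimately show ?thesis
    by simp
qed

text \<open>
  Tail invariance, stated for cylinders, means that exchanging initial segments preserves the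
  measure of every Borel set: both sides are measures in \<open>B\<close>, and they agree on long cylinders.
\<close>

lemma emeasure_replace_prefix:
  assumes same: "same_endpoint v es v' es'" and M: "sets M = sets path_borel"
    and fin: "finite_measure M" and inv: "tail_invariant M" and B: "B \<in> sets M"
  shows "emeasure M {x \<in> cylinder v es. replace_prefix es' x \<in> B} = emeasure M (B \<inter> cylinder v' es')"
proof -
  obtain w w' where w: "finite_path v es w" "finite_path v' es' w'" "length es = length es'"
    using same by (auto simp: same_endpoint_def)
  let ?C = "cylinder v es" and ?C' = "cylinder v' es'"
  let ?N = "distr (restrict_space M ?C) path_borel (replace_prefix es')"
  have C: "?C \<in> sets M" "?C' \<in> sets M"
    using w cylinder_in_path_measure[OF M] by blast+
  note space = space_restrict_cylinder[OF M, of v es]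
  have N: "emeasure ?N A = emeasure M {x \<in> ?C. replace_prefix es' x \<in> A}" if "A \<in> sets M" for A
  proof -
    have "emeasure ?N A = emeasure (restrict_space M ?C) (replace_prefix es' -` A \<inter> ?C)"
      using emeasure_distr[OF measurable_replace_prefix[OF same M]] that M space by auto
    also have "\<dots> = emeasure M (replace_prefix es' -` A \<inter> ?C)"
      using C by (intro emeasure_restrict_space sets.Int sets.top) auto
    also have "replace_prefix es' -` A \<inter> ?C = {x \<in> ?C. replace_prefix es' x \<in> A}"
      by blast
    finally show ?thesis .
  qed
  have R: "emeasure (density M (indicator ?C')) A = emeasure M (?C' \<inter> A)" if "A \<in> sets M" for A
    using emeasure_restricted[OF C(2) that] .
  have "?N = density M (indicator ?C')"
  proof (rule path_measure_eqI[where n = "length es"])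
    fix u gs z assume gs: "finite_path u gs z" "length es \<le> length gs"
    then have sets: "cylinder u gs \<in> sets M"
      using cylinder_in_path_measure[OF M] by blast
    show "emeasure ?N (cylinder u gs) \<noteq> \<infinity>"
      using N[OF sets] finite_measure.emeasure_finite[OF fin] by simp
    have "?C' \<inter> cylinder u gs
        = (if u = v' \<and> take (length es) gs = es' then cylinder u gs else {})"
      using cylinder_Int_shorter[of es' gs u v'] gs w by (simp add: Int_commute)
    moreover have "emeasure M (cylinder v (es @ drop (length es) gs)) = emeasure M (cylinder u gs)"
      if "u = v' \<and> take (length es) gs = es'"
      using inv finite_path_replace_prefix[OF same, of gs z] that gs
      unfolding tail_invariant_def by (metis append_take_drop_id length_append w(3))
    ultimately show "emeasure ?N (cylinder u gs) = emeasure (density M (indicator ?C')) (cylinder u gs)"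
      unfolding N[OF sets] R[OF sets] replace_prefix_preimage[OF same gs(2)] by simp
  qed (simp_all add: M)
  then show ?thesis
    using N[OF B] R[OF B] by (simp add: Int_commute)
qed

text \<open>
  Tail equivalent paths differ by the exchange of an initial segment, and there are only countably
  many pairs of segments. Saturations are therefore measurable and are governed by countably many
  measure preserving maps.
\<close>

lemma tail_saturation_eq:
  assumes "Y \<subseteq> path_space"
  shows "tail_rel `` Y = (\<Union>(v, es, v', es') \<in> {(v, es, v', es'). same_endpoint v es v' es'}.
    {y \<in> cylinder v' es'. replace_prefix es y \<in> Y})" (is "_ = ?R")
proof
  show "tail_rel `` Y \<subseteq> ?R"
  proof
    fix y assume "y \<in> tail_rel `` Y"
    then obtain x N where xy: "x \<in> Y" "x \<in> path_space" "y \<in> path_space" "\<forall>n\<ge>N. x n = y n"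
      by (auto simp: tail_rel_def)
    let ?es = "map x [0..<N]" and ?es' = "map y [0..<N]"
    have "x N = y N"
      using xy by simp
    then have "same_endpoint (fst (x 0)) ?es (fst (y 0)) ?es'"
      using finite_path_initial_segment[of x N] finite_path_initial_segment[of y N] xy
      by (auto simp: same_endpoint_def)
    moreover have "replace_prefix ?es y = x"
      using xy by (auto simp: replace_prefix_def)
    moreover have "y \<in> cylinder (fst (y 0)) ?es'"
      by (rule mem_cylinder_initial_segment[OF xy(3)])
    ultimately show "y \<in> ?R"
      using xy(1) by fastforce
  qed
  show "?R \<subseteq> tail_rel `` Y"
  proof
    fix y assume "y \<in> ?R"
    then obtain v es v' es' where y: "y \<in> cylinder v' es'" "replace_prefix es y \<in> Y"
      by blast
    then have "(replace_prefix es y, y) \<in> tail_rel"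
      using assms cylinder_subset_path_space unfolding tail_rel_def
      by (auto intro!: exI[of _ "length es"] simp: replace_prefix_def)
    with y show "y \<in> tail_rel `` Y"
      by blast
  qed
qed

lemma tail_saturation_in_sets:
  assumes M: "sets M = sets path_borel" and Y: "Y \<in> sets M"
  shows "tail_rel `` Y \<in> sets M"
proof -
  have "Y \<subseteq> path_space"
    using sets.sets_into_space[OF Y] path_measure_space[OF M] by simp
  show ?thesis
    unfolding tail_saturation_eq[OF \<open>Y \<subseteq> path_space\<close>]
  proof (rule sets.countable_UN'')
    show "countable {(v, es, v', es'). same_endpoint v es v' es'}"
      by (rule countableI_type)
  qed (use replace_prefix_preimage_in_sets[OF same_endpoint_sym M Y] in auto)
qed

lemma tail_saturation_idem: "tail_rel `` (tail_rel `` Y) = tail_rel `` Y"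
proof -
  have "tail_rel `` (tail_rel `` Y) \<subseteq> tail_rel `` Y"
  proof
    fix z assume "z \<in> tail_rel `` (tail_rel `` Y)"
    then obtain x y k l where "x \<in> Y" "x \<in> path_space" "z \<in> path_space"
        "\<forall>n\<ge>k. x n = y n" "\<forall>n\<ge>l. y n = z n"
      by (auto simp: tail_rel_def)
    then have "(x, z) \<in> tail_rel"
      unfolding tail_rel_def by (auto intro!: exI[of _ "max k l"])
    with \<open>x \<in> Y\<close> show "z \<in> tail_rel `` Y"
      by blast
  qed
  moreover have "y \<in> tail_rel `` (tail_rel `` Y)" if "y \<in> tail_rel `` Y" for y
  proof -
    have "(y, y) \<in> tail_rel"
      using that by (auto simp: tail_rel_def)
    with that show ?thesis
      by blast
  qed
  ultimately show ?thesis
    by blast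
qed

text \<open>
  The restriction of a tail invariant measure to an invariant set is tail invariant, as the exchange
  of initial segments maps the set to itself.
\<close>

lemma emeasure_invariant_Int_cylinder:
  assumes same: "same_endpoint v es v' es'" and M: "sets M = sets path_borel"
    and fin: "finite_measure M" and inv: "tail_invariant M"
    and A: "A \<in> sets M" "tail_rel `` A = A"
  shows "emeasure M (A \<inter> cylinder v es) = emeasure M (A \<inter> cylinder v' es')"
proof -
  have "replace_prefix es' x \<in> A \<longleftrightarrow> x \<in> A" if x: "x \<in> cylinder v es" for x
  proof -
    have "replace_prefix es' x \<in> path_space" "x \<in> path_space"
      using x replace_prefix_in_cylinder[OF same x] cylinder_subset_path_space by blast+
    then have "(replace_prefix es' x, x) \<in> tail_rel" "(x, replace_prefix es' x) \<in> tail_rel"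
      unfolding tail_rel_def by (auto intro!: exI[of _ "length es'"] simp: replace_prefix_def)
    with A(2) show ?thesis
      by blast
  qed
  then have "{x \<in> cylinder v es. replace_prefix es' x \<in> A} = A \<inter> cylinder v es"
    by blast
  with emeasure_replace_prefix[OF same M fin inv A(1)] show ?thesis
    by simp
qed

section \<open>Invariant measures dominated by an ergodic measure\<close>

lemma emeasure_le_on_countable_UN:
  fixes Y :: "'i \<Rightarrow> 'a set"
  assumes sets: "sets N = sets M" and I: "countable I"
    and Y: "\<And>k. k \<in> I \<Longrightarrow> Y k \<in> sets M"
    and le: "\<And>k Z. k \<in> I \<Longrightarrow> Z \<in> sets M \<Longrightarrow> Z \<subseteq> Y k \<Longrightarrow> emeasure N Z \<le> emeasure M Z"
    and X: "X \<in> sets M" "X \<subseteq> (\<Union>k\<in>I. Y k)"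
  shows "emeasure N X \<le> emeasure M X"
proof (cases "I = {}")
  case True
  with X show ?thesis
    by simp
next
  case False
  let ?Y = "\<lambda>n. Y (from_nat_into I n)"
  let ?Z = "\<lambda>n. X \<inter> disjointed ?Y n"
  have I_nat: "from_nat_into I n \<in> I" for n
    using False by (rule from_nat_into)
  have Y_sets: "range ?Y \<subseteq> sets M"
    using Y I_nat by blast
  then have Z: "?Z n \<in> sets M" for n
    using X(1) sets.range_disjointed_sets[OF Y_sets] by blast
  have disj: "disjoint_family ?Z"
    using disjoint_family_disjointed[of ?Y] by (auto simp: disjoint_family_on_def)
  have XZ: "X = (\<Union>n. ?Z n)"
  proof -
    have "(\<Union>k\<in>I. Y k) = (\<Union>n. ?Y n)"
      using range_from_nat_into[OF False I] by (metis image_image)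
    then show ?thesis
      using X(2) UN_disjointed_eq[of ?Y] by auto
  qed
  have sums: "emeasure L X = (\<Sum>n. emeasure L (?Z n))" if "sets L = sets M" for L
  proof -
    have "range ?Z \<subseteq> sets L"
      using Z that by blast
    from suminf_emeasure[OF this disj] arg_cong[OF XZ, of "emeasure L"] show ?thesis
      by metis
  qed
  have "emeasure N (?Z n) \<le> emeasure M (?Z n)" for n
    by (rule le[OF I_nat[of n] Z]) (use disjointed_subset[of ?Y n] in blast)
  then show ?thesis
    unfolding sums[OF sets] sums[OF refl] by (intro suminf_le) auto
qed

lemma emeasure_eq_if_le_and_same_mass:
  assumes sets: "sets N = sets M" and fin: "finite_measure M" "finite_measure N"
    and le: "\<And>A. A \<in> sets M \<Longrightarrow> emeasure N A \<le> emeasure M A"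
    and mass: "emeasure N (space M) = emeasure M (space M)"
    and A: "A \<in> sets M"
  shows "emeasure N A = emeasure M A"
proof -
  interpret M: finite_measure M by (rule fin)
  interpret N: finite_measure N by (rule fin)
  have space: "space N = space M"
    using sets by (rule sets_eq_imp_space_eq)
  have le': "measure N B \<le> measure M B" if "B \<in> sets M" for B
    using le[OF that] by (simp add: M.emeasure_eq_measure N.emeasure_eq_measure)
  have "measure N (space M) = measure M (space M)"
    using mass by (simp add: M.emeasure_eq_measure N.emeasure_eq_measure)
  moreover have "measure M (space M - A) = measure M (space M) - measure M A"
    "measure N (space M - A) = measure N (space M) - measure N A"
    using M.finite_measure_compl[OF A] N.finite_measure_compl[of A] A sets space by simp_all
  ultimately have "measure N A = measure M A"
    using le'[OF A] le'[of "space M - A"] A by (simp add: sets.compl_sets)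
  then show ?thesis
    by (simp add: M.emeasure_eq_measure N.emeasure_eq_measure)
qed

text \<open>
  If one invariant measure is below another on all subsets of \<open>Y\<close>, it is so on all subsets of each
  image of \<open>Y\<close> under an exchange of initial segments, since both measures are preserved; and the
  saturation is the union of countably many such images.
\<close>

lemma emeasure_le_on_saturation:
  assumes M: "sets M = sets path_borel" "finite_measure M" "tail_invariant M"
    and N: "sets N = sets path_borel" "finite_measure N" "tail_invariant N"
    and Y: "Y \<in> sets M"
    and le: "\<And>Z. Z \<in> sets M \<Longrightarrow> Z \<subseteq> Y \<Longrightarrow> emeasure N Z \<le> emeasure M Z"
    and X: "X \<in> sets M" "X \<subseteq> tail_rel `` Y"
  shows "emeasure N X \<le> emeasure M X"
proof -
  have Y_sub: "Y \<subseteq> path_space"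
    using sets.sets_into_space[OF Y] path_measure_space[OF M(1)] by simp
  define I where "I = {(v, es, v', es'). same_endpoint v es v' es'}"
  define F :: "nat \<times> edge list \<times> nat \<times> edge list \<Rightarrow> (nat \<Rightarrow> edge) set"
    where "F = (\<lambda>(v, es, v', es'). {y \<in> cylinder v' es'. replace_prefix es y \<in> Y})"
  have "tail_rel `` Y = (\<Union>k\<in>I. F k)"
    unfolding tail_saturation_eq[OF Y_sub] I_def F_def by simp
  show ?thesis
  proof (rule emeasure_le_on_countable_UN[where I = I and Y = F])
    show "sets N = sets M"
      using M N by simp
    show "countable I"
      by (rule countableI_type)
    show "X \<subseteq> (\<Union>k\<in>I. F k)"
      using X \<open>tail_rel `` Y = _\<close> by simp
    fix k assume "k \<in> I"
    then obtain v es v' es' where k: "k = (v, es, v', es')" and same: "same_endpoint v es v' es'"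
      by (auto simp: I_def)
    have Fk: "F k = {y \<in> cylinder v' es'. replace_prefix es y \<in> Y}"
      by (simp add: F_def k)
    show "F k \<in> sets M"
      unfolding Fk by (rule replace_prefix_preimage_in_sets[OF same_endpoint_sym[OF same] M(1) Y])
    fix Z assume Z: "Z \<in> sets M" "Z \<subseteq> F k"
    let ?Z' = "{x \<in> cylinder v es. replace_prefix es' x \<in> Z}"
    have "?Z' \<subseteq> Y"
    proof
      fix x assume x: "x \<in> ?Z'"
      have "length es = length es'"
        using same by (simp add: same_endpoint_def)
      then have "replace_prefix es (replace_prefix es' x) = x"
        using x replace_prefix_inverse by blast
      with x Z(2) Fk show "x \<in> Y"
        by auto
    qed
    moreover have "?Z' \<in> sets M"
      by (rule replace_prefix_preimage_in_sets[OF same M(1) Z(1)])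
    ultimately have "emeasure N ?Z' \<le> emeasure M ?Z'"
      by (rule le[rotated])
    moreover have "Z \<inter> cylinder v' es' = Z"
      using Z(2) Fk by blast
    moreover have "Z \<in> sets N"
      using Z(1) M(1) N(1) by simp
    ultimately show "emeasure N Z \<le> emeasure M Z"
      using emeasure_replace_prefix[OF same M Z(1)] emeasure_replace_prefix[OF same N, of Z]
      by simp
  qed (rule X(1))
qed

text \<open>
  Let \<open>c\<close> be the total mass of \<open>N\<close> and split the space by a Hahn decomposition into \<open>Y\<close>, where
  \<open>N \<le> c M\<close>, and its complement, where \<open>c M \<le> N\<close>. The first inequality extends to the saturation
  of \<open>Y\<close>, which by ergodicity is null or has a null complement. So one of the two inequalities holds
  on the whole space, and it is an equality because the total masses agree.
\<close>

lemma ergodic_dominated_proportional: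
  assumes M: "sets M = sets path_borel" "prob_space M" "tail_invariant M" "tail_ergodic M"
    and N: "sets N = sets path_borel" "tail_invariant N"
    and dom: "\<And>A. A \<in> sets M \<Longrightarrow> emeasure N A \<le> emeasure M A"
    and A: "A \<in> sets M"
  shows "emeasure N A = emeasure N path_space * emeasure M A"
proof -
  interpret M: prob_space M by (rule M)
  have space: "space M = path_space" "space N = path_space"
    using path_measure_space M(1) N(1) by simp_all
  have "emeasure N path_space \<le> 1"
    using dom[OF sets.top] M.emeasure_space_1 space by simp
  then have c_fin: "emeasure N path_space \<noteq> \<infinity>"
    by (auto simp: top_unique)
  interpret N: finite_measure N
    by (rule finite_measureI) (use c_fin space in simp)
  let ?c = "emeasure N path_space"
  define K where "K = scale_measure ?c M"
  have K: "sets K = sets path_borel" "space K = path_space" "tail_invariant K"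
    using M(1,3) space by (simp_all add: K_def tail_invariant_def space_scale_measure)
  have K_emeasure: "emeasure K B = ?c * emeasure M B" for B
    by (simp add: K_def)
  have K_fin: "finite_measure K"
    by (rule finite_measureI)
      (use c_fin M.emeasure_space_1 space K in \<open>simp add: K_emeasure\<close>)
  have sets: "sets N = sets K"
    using N K by simp
  from finite_unsigned_Hahn_decomposition[OF K_fin N.finite_measure_axioms sets]
  obtain Y where Y0: "Y \<in> sets K" "\<forall>X\<in>sets K. X \<subseteq> Y \<longrightarrow> emeasure N X \<le> emeasure K X"
      "\<forall>X\<in>sets K. X \<inter> Y = {} \<longrightarrow> emeasure K X \<le> emeasure N X"
    by (elim bexE conjE)
  then have Y: "Y \<in> sets K" "\<And>X. X \<in> sets K \<Longrightarrow> X \<subseteq> Y \<Longrightarrow> emeasure N X \<le> emeasure K X"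
      "\<And>X. X \<in> sets K \<Longrightarrow> X \<inter> Y = {} \<Longrightarrow> emeasure K X \<le> emeasure N X"
    by simp_all
  let ?S = "tail_rel `` Y"
  have S: "?S \<in> sets K" "Y \<subseteq> ?S"
  proof -
    show "?S \<in> sets K"
      by (rule tail_saturation_in_sets[OF K(1) Y(1)])
    have "(y, y) \<in> tail_rel" if "y \<in> Y" for y
      using sets.sets_into_space[OF Y(1)] that K(2) by (auto simp: tail_rel_def)
    then show "Y \<subseteq> ?S"
      by blast
  qed
  have mass: "emeasure N path_space = emeasure K path_space"
    using M.emeasure_space_1 space by (simp add: K_emeasure)
  have "emeasure M ?S = 0 \<or> emeasure M (space M - ?S) = 0"
    using M(1,4) K(1) S(1) tail_saturation_idem[of Y] by (simp add: tail_ergodic_def)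
  then have "emeasure N A = emeasure K A"
  proof
    assume S0: "emeasure M ?S = 0"
    have "emeasure K B \<le> emeasure N B" if B: "B \<in> sets K" for B
    proof -
      have "emeasure K Y \<le> emeasure K ?S"
        by (rule emeasure_mono[OF S(2,1)])
      then have "emeasure K Y = 0"
        using S0 by (simp add: K_emeasure)
      then have "emeasure K B = emeasure K (B - Y)"
        using emeasure_Diff_null_set[of Y K B] Y(1) B by (simp add: null_setsI)
      also have "\<dots> \<le> emeasure N (B - Y)"
        using B Y(1) by (intro Y(3)) auto
      also have "\<dots> \<le> emeasure N B"
        using B sets by (intro emeasure_mono) auto
      finally show ?thesis .
    qed
    then show ?thesis
      using emeasure_eq_if_le_and_same_mass[of K N A] K_fin N.finite_measure_axioms mass A M(1)
        N(1) K(1) space by simp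
  next
    assume S1: "emeasure M (space M - ?S) = 0"
    have "emeasure N B \<le> emeasure K B" if B: "B \<in> sets K" for B
    proof -
      have "emeasure N (space M - ?S) \<le> emeasure M (space M - ?S)"
        using S(1) M(1) K(1) by (intro dom) auto
      then have "space M - ?S \<in> null_sets N"
        using S1 S(1) M(1) K(1) N(1) by (intro null_setsI) auto
      moreover have "B - (space M - ?S) = B \<inter> ?S"
        using sets.sets_into_space[OF B] space K(2) by blast
      ultimately have "emeasure N B = emeasure N (B \<inter> ?S)"
        using emeasure_Diff_null_set[of "space M - ?S" N B] B sets by simp
      also have "\<dots> \<le> emeasure K (B \<inter> ?S)"
        by (rule emeasure_le_on_saturation[OF K(1) K_fin K(3) N(1) N.finite_measure_axioms N(2) Y(1)])
          (use Y(2) B S(1) in auto)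
      also have "\<dots> \<le> emeasure K B"
        using B by (intro emeasure_mono) auto
      finally show ?thesis .
    qed
    then show ?thesis
      using emeasure_eq_if_le_and_same_mass[of N K A] K_fin N.finite_measure_axioms mass A M(1)
        N(1) K(1,2) by simp
  qed
  then show ?thesis
    by (simp add: K_emeasure)
qed

section \<open>Geometric start and Bernoulli steps\<close>

text \<open>
  A path from \<open>v\<close> to \<open>w\<close> has \<open>w - v\<close> diagonal edges, and each of them contributes the factor
  \<open>1 - p = p * ((1 - p) / p)\<close>.
\<close>

lemma path_weight:
  assumes "finite_path v es w" "p \<noteq> 0"
  shows "v \<le> w \<and> prod_list (map (edge_weight p) es) = p ^ length es * ((1 - p) / p) ^ (w - v)"
  using assms(1)
proof (induction v es w rule: finite_path.induct)
  case (2 v e es w)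
  then have e: "e \<in> edges" "fst e = v" and IH: "snd e \<le> w"
      "prod_list (map (edge_weight p) es) = p ^ length es * ((1 - p) / p) ^ (w - snd e)"
    by simp_all
  have "snd e = v \<or> snd e = Suc v"
    using e by (auto simp: edges_def)
  then show ?case
  proof
    assume "snd e = v"
    with IH e show ?thesis
      by (simp add: edge_weight_def[of p e] mult.assoc)
  next
    assume s: "snd e = Suc v"
    with IH have "w - v = Suc (w - snd e)"
      by simp
    with IH e s \<open>p \<noteq> 0\<close> show ?thesis
      by (simp add: edge_weight_def[of p e] field_simps)
  qed
qed simp

text \<open>
  The start vertex is shifted by one, since geometric distributions live on the numbers from 0 on.
  A step is \<open>True\<close> if it is diagonal.
\<close>

definition path_from_steps :: "nat \<times> (nat \<Rightarrow> bool) \<Rightarrow> nat \<Rightarrow> edge" where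
  "path_from_steps = (\<lambda>(a, b) k. (Suc a + (\<Sum>j<k. of_bool (b j)), Suc a + (\<Sum>j<Suc k. of_bool (b j))))"

lemma path_from_steps_in_path_space: "path_from_steps x \<in> path_space"
  by (cases x) (auto simp: path_from_steps_def path_space_def edges_def simp del: sum_of_bool_eq)

lemma path_from_steps_in_cylinder_iff:
  assumes "finite_path v es w"
  shows "path_from_steps (a, b) \<in> cylinder v es \<longleftrightarrow>
    Suc a = v \<and> (\<forall>k < length es. b k \<longleftrightarrow> snd (es ! k) \<noteq> fst (es ! k))"
  using assms
proof (induction es arbitrary: w rule: rev_induct)
  case Nil
  have "path_from_steps (a, b) \<in> path_space"
    by (rule path_from_steps_in_path_space)
  then show ?case
    by (auto simp: cylinder_def path_from_steps_def)
next
  case (snoc e es)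
  let ?x = "path_from_steps (a, b)"
  have es: "finite_path v es (fst e)" and e: "e \<in> edges"
    using snoc.prems by (simp_all add: finite_path_snoc)
  have "?x (length es) = e \<longleftrightarrow> (b (length es) \<longleftrightarrow> snd e \<noteq> fst e)" if "?x \<in> cylinder v es"
  proof -
    have start: "fst (?x (length es)) = fst e"
      by (rule cylinder_endpoint[OF that es])
    moreover have "snd (?x (length es)) = fst (?x (length es)) + of_bool (b (length es))"
      by (simp add: path_from_steps_def)
    ultimately show ?thesis
      using e by (auto simp: edges_def prod_eq_iff)
  qed
  then have "?x \<in> cylinder v (es @ [e]) \<longleftrightarrow>
      ?x \<in> cylinder v es \<and> (b (length es) \<longleftrightarrow> snd e \<noteq> fst e)"
    by (auto simp: cylinder_append)
  then show ?case
    unfolding snoc.IH[OF es] by (auto simp: nth_append less_Suc_eq)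
qed

definition bernoulli_steps :: "real \<Rightarrow> (nat \<Rightarrow> bool) measure" where
  "bernoulli_steps p = PiM UNIV (\<lambda>_. measure_pmf (bernoulli_pmf (1 - p)))"

definition geometric_bernoulli :: "real \<Rightarrow> (nat \<Rightarrow> edge) measure" where
  "geometric_bernoulli p =
    distr (measure_pmf (geometric_pmf (1 - (1 - p) / p)) \<Otimes>\<^sub>M bernoulli_steps p) path_borel path_from_steps"

lemma product_prob_bernoulli:
  "product_prob_space (\<lambda>_ :: nat. measure_pmf (bernoulli_pmf (1 - p)))"
  by (rule product_prob_spaceI) (rule prob_space_measure_pmf)

lemma space_bernoulli_steps [simp]: "space (bernoulli_steps p) = UNIV"
  by (simp add: bernoulli_steps_def space_PiM)

lemma prob_space_bernoulli_steps: "prob_space (bernoulli_steps p)"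
  unfolding bernoulli_steps_def by (intro prob_space_PiM prob_space_measure_pmf)

lemma path_from_steps_preimage:
  assumes "finite_path v es w"
  shows "path_from_steps -` cylinder v es
    = {v - 1} \<times> {b. \<forall>k \<in> {..<length es}. b k \<in> {snd (es ! k) \<noteq> fst (es ! k)}}"
  using path_from_steps_in_cylinder_iff[OF assms] finite_path_source_ge1[OF assms] by auto

lemma sets_bernoulli_steps_cylinder:
  "finite J \<Longrightarrow> {b. \<forall>k \<in> J. b k \<in> X k} \<in> sets (bernoulli_steps p)"
proof -
  assume "finite J"
  have "{b \<in> space (bernoulli_steps p). \<forall>k \<in> J. b k \<in> X k} \<in> sets (bernoulli_steps p)"
    unfolding bernoulli_steps_def
    by (intro sets.sets_Collect_finite_All sets_Collect_single \<open>finite J\<close>) auto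
  then show ?thesis
    by simp
qed

lemma measurable_path_from_steps:
  "path_from_steps \<in> measurable (measure_pmf q \<Otimes>\<^sub>M bernoulli_steps p) path_borel"
proof (rule measurable_path_borelI[where n = 0])
  fix v es w assume es: "finite_path v es w"
  have "path_from_steps -` cylinder v es \<in> sets (measure_pmf q \<Otimes>\<^sub>M bernoulli_steps p)"
    unfolding path_from_steps_preimage[OF es]
    by (intro pair_measureI sets_bernoulli_steps_cylinder) simp_all
  then show "path_from_steps -` cylinder v es \<inter> space (measure_pmf q \<Otimes>\<^sub>M bernoulli_steps p)
      \<in> sets (measure_pmf q \<Otimes>\<^sub>M bernoulli_steps p)"
    by (simp add: space_pair_measure)
qed (rule path_from_steps_in_path_space)

lemma prob_space_geometric_bernoulli: "prob_space (geometric_bernoulli p)"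
proof -
  interpret S: prob_space "bernoulli_steps p"
    by (rule prob_space_bernoulli_steps)
  interpret pair_prob_space "measure_pmf (geometric_pmf (1 - (1 - p) / p))" "bernoulli_steps p"
    by unfold_locales
  show ?thesis
    unfolding geometric_bernoulli_def by (rule prob_space_distr[OF measurable_path_from_steps])
qed

lemma sets_geometric_bernoulli [simp]: "sets (geometric_bernoulli p) = sets path_borel"
  by (simp add: geometric_bernoulli_def)

lemma space_geometric_bernoulli [simp]: "space (geometric_bernoulli p) = path_space"
  by (simp add: geometric_bernoulli_def)

text \<open>
  The mass at the end \<open>w\<close> on level \<open>n\<close>: a start at \<open>v\<close> has the probability
  \<open>(1 - \<lambda>) * \<lambda> ^ (v - 1)\<close> with \<open>\<lambda> = (1 - p) / p\<close>, and the steps from \<open>v\<close> to \<open>w\<close> contribute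
  \<open>p ^ n * \<lambda> ^ (w - v)\<close>, so \<open>v\<close> cancels. This is why the measure is tail invariant.
\<close>

definition cylinder_mass :: "real \<Rightarrow> nat \<Rightarrow> nat \<Rightarrow> real" where
  "cylinder_mass p n w = (1 - (1 - p) / p) * ((1 - p) / p) ^ (w - 1) * p ^ n"

lemma emeasure_geometric_bernoulli:
  assumes p: "1 / 2 < p" "p < 1" and es: "finite_path v es w"
  shows "emeasure (geometric_bernoulli p) (cylinder v es) = ennreal (cylinder_mass p (length es) w)"
proof -
  let ?G = "measure_pmf (geometric_pmf (1 - (1 - p) / p))"
  let ?X = "\<lambda>k. {snd (es ! k) \<noteq> fst (es ! k)}"
  interpret P: product_prob_space "\<lambda>_ :: nat. measure_pmf (bernoulli_pmf (1 - p))" UNIV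
    by (rule product_prob_bernoulli)
  interpret S: prob_space "bernoulli_steps p"
    by (rule prob_space_bernoulli_steps)
  have step: "emeasure (measure_pmf (bernoulli_pmf (1 - p))) (?X k) = ennreal (edge_weight p (es ! k))"
    for k
    using p by (simp add: emeasure_pmf_single edge_weight_def)
  have "emeasure (bernoulli_steps p) {b. \<forall>k \<in> {..<length es}. b k \<in> ?X k}
      = (\<Prod>k<length es. ennreal (edge_weight p (es ! k)))"
    using P.emeasure_PiM_Collect[of "{..<length es}" ?X] unfolding step
    by (simp add: bernoulli_steps_def space_PiM)
  also have "\<dots> = ennreal (\<Prod>k<length es. edge_weight p (es ! k))"
    using p by (intro prod_ennreal) (auto simp: edge_weight_def)
  also have "(\<Prod>k<length es. edge_weight p (es ! k)) = prod_list (map (edge_weight p) es)"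
    by (simp add: prod.list_conv_set_nth atLeast0LessThan)
  finally have steps: "emeasure (bernoulli_steps p) {b. \<forall>k \<in> {..<length es}. b k \<in> ?X k}
      = ennreal (prod_list (map (edge_weight p) es))" .
  have q: "0 < 1 - (1 - p) / p" "1 - (1 - p) / p \<le> 1"
    using p by (simp_all add: field_simps)
  have start: "emeasure ?G {v - 1} = ennreal (((1 - p) / p) ^ (v - 1) * (1 - (1 - p) / p))"
    using q by (simp add: emeasure_pmf_single pmf_geometric)
  have "emeasure (geometric_bernoulli p) (cylinder v es)
      = emeasure (?G \<Otimes>\<^sub>M bernoulli_steps p) (path_from_steps -` cylinder v es)"
    unfolding geometric_bernoulli_def
    by (subst emeasure_distr[OF measurable_path_from_steps cylinder_in_sets[OF es]])
      (simp add: space_pair_measure)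
  also have "\<dots> = emeasure ?G {v - 1} * emeasure (bernoulli_steps p) {b. \<forall>k \<in> {..<length es}. b k \<in> ?X k}"
    unfolding path_from_steps_preimage[OF es]
    by (rule S.emeasure_pair_measure_Times) (simp, rule sets_bernoulli_steps_cylinder, simp)
  also have "\<dots> = ennreal (((1 - p) / p) ^ (v - 1) * (1 - (1 - p) / p) *
      (p ^ length es * ((1 - p) / p) ^ (w - v)))"
    unfolding start steps using p q path_weight[OF es, of p] by (simp add: ennreal_mult')
  also have "((1 - p) / p) ^ (v - 1) * (1 - (1 - p) / p) * (p ^ length es * ((1 - p) / p) ^ (w - v))
      = cylinder_mass p (length es) w"
  proof -
    have "w - 1 = (v - 1) + (w - v)"
      using path_weight[OF es, of p] finite_path_source_ge1[OF es] p by simp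
    then have "((1 - p) / p) ^ (w - 1) = ((1 - p) / p) ^ (v - 1) * ((1 - p) / p) ^ (w - v)"
      by (simp add: power_add)
    then show ?thesis
      by (simp add: cylinder_mass_def)
  qed
  finally show ?thesis .
qed

section \<open>Bounded harmonic functions of the random walk\<close>

text \<open>
  The Choquet-Deny argument. Where \<open>D\<close> is almost equal to its supremum, so it is at both successors,
  because it is their weighted mean. After \<open>j\<close> rounds it is almost equal to the supremum at \<open>j + 1\<close>
  neighbouring points, so that the bounded sums force the supremum to be nonpositive.
\<close>

lemma harmonic_differences_nonpos:
  fixes D :: "nat \<Rightarrow> nat \<Rightarrow> real"
  assumes p: "0 < p" "p < 1"
    and harm: "\<And>n k. D n k = p * D (Suc n) k + (1 - p) * D (Suc n) (Suc k)"
    and sums: "\<And>n k j. (\<Sum>l\<le>j. D n (k + l)) \<le> 1"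
  shows "D n k \<le> 0"
proof (rule ccontr)
  assume pos: "\<not> D n k \<le> 0"
  have D_le_1: "D n k \<le> 1" for n k
    using sums[of n k 0] by simp
  define S where "S = (SUP (n, k). D n k)"
  have bdd: "bdd_above (range (\<lambda>(n, k). D n k))"
    using D_le_1 by (auto intro!: bdd_aboveI[of _ 1])
  have D_le: "D n k \<le> S" for n k
    unfolding S_def using cSUP_upper[OF UNIV_I bdd, of "(n, k)"] by simp
  have S: "0 < S"
    using pos D_le[of n k] by simp
  define q where "q = min p (1 - p)"
  have q: "0 < q" "q \<le> p" "q \<le> 1 - p"
    using p by (auto simp: q_def)
  obtain j where j: "2 / S < real j"
    using reals_Archimedean2 by blast
  \<comment> \<open>One round multiplies the error by at most \<open>1 / q\<close>, so after \<open>j\<close> rounds it is still at most \<open>S / 2\<close>.\<close>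
  define \<epsilon> where "\<epsilon> = q ^ j * (S / 2)"
  have \<epsilon>: "0 < \<epsilon>"
    using q S by (simp add: \<epsilon>_def)
  then obtain n k where nk: "S - \<epsilon> < D n k"
    using less_cSUP_iff[OF UNIV_not_empty bdd, of "S - \<epsilon>"] unfolding S_def by auto
  have near: "S - \<epsilon> / q ^ i \<le> D (n + i) (k + l)" if "l \<le> i" for i l
    using that
  proof (induction i arbitrary: l)
    case 0
    with nk show ?case
      by simp
  next
    case (Suc i)
    have both: "S - \<epsilon> / q ^ Suc i \<le> D (Suc (n + i)) (k + l) \<and>
        S - \<epsilon> / q ^ Suc i \<le> D (Suc (n + i)) (Suc (k + l))" if "l \<le> i" for l
    proof -
      let ?a = "D (Suc (n + i)) (k + l)" and ?b = "D (Suc (n + i)) (Suc (k + l))"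
      let ?e = "\<epsilon> / q ^ i"
      have ab: "S - ?e \<le> p * ?a + (1 - p) * ?b"
        using Suc.IH[OF that] harm[of "n + i" "k + l"] by simp
      have "p * (S - ?a) + (1 - p) * (S - ?b) \<le> ?e"
        using ab by (simp add: algebra_simps)
      moreover have "q * (S - ?a) \<le> p * (S - ?a)" "q * (S - ?b) \<le> (1 - p) * (S - ?b)"
        using q D_le[of "Suc (n + i)" "k + l"] D_le[of "Suc (n + i)" "Suc (k + l)"]
        by (intro mult_right_mono; simp)+
      moreover have "0 \<le> q * (S - ?a)" "0 \<le> q * (S - ?b)"
        using q D_le[of "Suc (n + i)" "k + l"] D_le[of "Suc (n + i)" "Suc (k + l)"] by simp_all
      ultimately have "q * (S - ?a) \<le> ?e" "q * (S - ?b) \<le> ?e"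
        by linarith+
      then have "S - ?a \<le> ?e / q" "S - ?b \<le> ?e / q"
        using q by (simp_all add: field_simps)
      then show ?thesis
        by (simp add: mult.commute)
    qed
    show ?case
    proof (cases "l \<le> i")
      case True
      with both show ?thesis
        by simp
    next
      case False
      with Suc.prems have "l = Suc i"
        by simp
      with both[of i] show ?thesis
        by simp
    qed
  qed
  have "\<epsilon> / q ^ j = S / 2"
    using q by (simp add: \<epsilon>_def)
  then have "S / 2 \<le> D (n + j) (k + l)" if "l \<le> j" for l
    using near[OF that] unfolding \<open>\<epsilon> / q ^ j = S / 2\<close> by simp
  then have "(\<Sum>l\<le>j. S / 2) \<le> (\<Sum>l\<le>j. D (n + j) (k + l))"
    by (intro sum_mono) simp
  also have "\<dots> \<le> 1"
    by (rule sums)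
  finally have "(real j + 1) * (S / 2) \<le> 1"
    by (simp add: add.commute)
  moreover have "1 < (real j + 1) * (S / 2)"
    using j S by (simp add: field_simps)
  ultimately show False
    by simp
qed

text \<open>
  The differences of horizontal neighbours are harmonic, and their sums telescope, hence are bounded
  by 1. So \<open>u\<close> does not depend on \<open>k\<close>, and then harmonicity shows that it does not depend on \<open>n\<close>.
\<close>

lemma bounded_harmonic_constant:
  fixes u :: "nat \<Rightarrow> nat \<Rightarrow> real"
  assumes p: "0 < p" "p < 1"
    and harm: "\<And>n k. u n k = p * u (Suc n) k + (1 - p) * u (Suc n) (Suc k)"
    and bounds: "\<And>n k. 0 \<le> u n k" "\<And>n k. u n k \<le> 1"
  shows "u n k = u 0 0"
proof -
  have telescope: "(\<Sum>l\<le>j. u n (k + l) - u n (Suc (k + l))) = u n k - u n (Suc (k + j))" for n k j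
    by (induction j) auto
  have "c * (u n k - u n (Suc k)) \<le> 0" if c: "c = 1 \<or> c = -1" for c n k
  proof (rule harmonic_differences_nonpos[OF p, of "\<lambda>n k. c * (u n k - u n (Suc k))"])
    fix n k j
    have "u n k - u n (Suc k) = p * (u (Suc n) k - u (Suc n) (Suc k)) +
        (1 - p) * (u (Suc n) (Suc k) - u (Suc n) (Suc (Suc k)))"
      using harm[of n k] harm[of n "Suc k"] by (simp add: algebra_simps)
    with c show "c * (u n k - u n (Suc k)) = p * (c * (u (Suc n) k - u (Suc n) (Suc k))) +
        (1 - p) * (c * (u (Suc n) (Suc k) - u (Suc n) (Suc (Suc k))))"
      by (auto simp: algebra_simps)
    have "(\<Sum>l\<le>j. c * (u n (k + l) - u n (Suc (k + l)))) = c * (u n k - u n (Suc (k + j)))"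
      by (simp only: sum_distrib_left[symmetric] telescope)
    also have "\<dots> \<le> 1"
      using c bounds(1)[of n k] bounds(2)[of n k] bounds(1)[of n "Suc (k + j)"]
        bounds(2)[of n "Suc (k + j)"] by auto
    finally show "(\<Sum>l\<le>j. c * (u n (k + l) - u n (Suc (k + l)))) \<le> 1" .
  qed
  from this[of 1] this[of "-1"] have "u n (Suc k) = u n k" for n k
    by (simp add: order_antisym)
  then have right: "u n k = u n 0" for n k
    by (induction k) simp_all
  have "u n 0 = p * u (Suc n) 0 + (1 - p) * u (Suc n) 0" for n
    using harm[of n 0] right[of "Suc n" "Suc 0"] by simp
  then have "u (Suc n) 0 = u n 0" for n
    by (simp add: algebra_simps)
  then have "u n 0 = u 0 0"
    by (induction n) simp_all
  with right[of n k] show ?thesis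
    by simp
qed

section \<open>Ergodicity of the geometric-Bernoulli measures\<close>

text \<open>
  A standard representative of the cylinders with end \<open>w\<close> on level \<open>n\<close>.
\<close>

definition vertical_cylinder :: "nat \<Rightarrow> nat \<Rightarrow> (nat \<Rightarrow> edge) set" where
  "vertical_cylinder n w = cylinder w (replicate n (w, w))"

lemma measure_invariant_Int_cylinder:
  assumes M: "sets M = sets path_borel" "finite_measure M" "tail_invariant M"
    and A: "A \<in> sets M" "tail_rel `` A = A" and es: "finite_path v es w"
  shows "measure M (A \<inter> cylinder v es) = measure M (A \<inter> vertical_cylinder (length es) w)"
proof -
  have "same_endpoint v es w (replicate (length es) (w, w))"
    using es finite_path_vertical[OF finite_path_range_ge1[OF es]] by (auto simp: same_endpoint_def)
  from emeasure_invariant_Int_cylinder[OF this M A] show ?thesis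
    by (simp add: measure_def vertical_cylinder_def)
qed

lemma measure_invariant_harmonic:
  assumes M: "sets M = sets path_borel" "finite_measure M" "tail_invariant M"
    and A: "A \<in> sets M" "tail_rel `` A = A" and w: "1 \<le> w"
  shows "measure M (A \<inter> vertical_cylinder n w)
    = measure M (A \<inter> vertical_cylinder (Suc n) w) + measure M (A \<inter> vertical_cylinder (Suc n) (Suc w))"
proof -
  interpret finite_measure M by (rule M)
  let ?es = "replicate n (w, w)"
  have es: "finite_path w ?es w"
    by (rule finite_path_vertical[OF w])
  have stay: "finite_path w (?es @ [(w, w)]) w" and move: "finite_path w (?es @ [(w, Suc w)]) (Suc w)"
    using es w by (simp_all add: finite_path_snoc edges_def)
  have "A \<inter> vertical_cylinder n w
      = A \<inter> cylinder w (?es @ [(w, w)]) \<union> A \<inter> cylinder w (?es @ [(w, Suc w)])"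
    unfolding vertical_cylinder_def cylinder_split[OF es] by blast
  moreover have "(A \<inter> cylinder w (?es @ [(w, w)])) \<inter> (A \<inter> cylinder w (?es @ [(w, Suc w)])) = {}"
    using cylinder_split_disjoint by blast
  moreover have "A \<inter> cylinder w (?es @ [(w, w)]) \<in> sets M" "A \<inter> cylinder w (?es @ [(w, Suc w)]) \<in> sets M"
    using A(1) cylinder_in_path_measure[OF M(1)] stay move by blast+
  ultimately have "measure M (A \<inter> vertical_cylinder n w)
      = measure M (A \<inter> cylinder w (?es @ [(w, w)])) + measure M (A \<inter> cylinder w (?es @ [(w, Suc w)]))"
    using finite_measure_Union by simp
  then show ?thesis
    using measure_invariant_Int_cylinder[OF M A stay] measure_invariant_Int_cylinder[OF M A move] by simp
qed

lemma measure_cylinder_vertical: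
  assumes M: "sets M = sets path_borel" "finite_measure M" "tail_invariant M"
    and es: "finite_path v es w"
  shows "measure M (cylinder v es) = measure M (vertical_cylinder (length es) w)"
proof -
  have "same_endpoint v es w (replicate (length es) (w, w))"
    using es finite_path_vertical[OF finite_path_range_ge1[OF es]] by (auto simp: same_endpoint_def)
  then have "emeasure M (cylinder v es) = emeasure M (cylinder w (replicate (length es) (w, w)))"
    using M(3) unfolding same_endpoint_def tail_invariant_def by blast
  then show ?thesis
    by (simp add: measure_def vertical_cylinder_def)
qed

lemma measure_vertical_cylinder_harmonic:
  assumes M: "sets M = sets path_borel" "finite_measure M" "tail_invariant M" and w: "1 \<le> w"
  shows "measure M (vertical_cylinder n w)
    = measure M (vertical_cylinder (Suc n) w) + measure M (vertical_cylinder (Suc n) (Suc w))"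
proof -
  have "(x, x) \<in> tail_rel" if "x \<in> path_space" for x
    using that by (auto simp: tail_rel_def)
  then have "tail_rel `` path_space = path_space"
    by (auto simp: tail_rel_def)
  moreover have "path_space \<in> sets M"
    using sets.top[of M] path_measure_space[OF M(1)] by simp
  moreover have "path_space \<inter> vertical_cylinder n w = vertical_cylinder n w" for n w
    using cylinder_subset_path_space by (auto simp: vertical_cylinder_def)
  ultimately show ?thesis
    using measure_invariant_harmonic[OF M _ _ w, of path_space n] by simp
qed

lemma cylinder_mass_pos: "1 / 2 < p \<Longrightarrow> p < 1 \<Longrightarrow> 0 < cylinder_mass p n w"
  by (auto simp: cylinder_mass_def field_simps intro!: mult_pos_pos)

lemma measure_geometric_bernoulli:
  assumes "1 / 2 < p" "p < 1" "finite_path v es w"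
  shows "measure (geometric_bernoulli p) (cylinder v es) = cylinder_mass p (length es) w"
  using emeasure_geometric_bernoulli[OF assms] cylinder_mass_pos[OF assms(1,2)]
  by (simp add: measure_def less_imp_le)

lemma tail_invariant_geometric_bernoulli:
  assumes "1 / 2 < p" "p < 1"
  shows "tail_invariant (geometric_bernoulli p)"
  unfolding tail_invariant_def
proof (intro allI impI, elim conjE)
  fix v es v' es' w
  assume "finite_path v es w" "finite_path v' es' w" "length es = length es'"
  then show "emeasure (geometric_bernoulli p) (cylinder v es)
      = emeasure (geometric_bernoulli p) (cylinder v' es')"
    by (simp only: emeasure_geometric_bernoulli[OF assms])
qed

text \<open>
  Cylinders of length \<open>n\<close> have mass at most \<open>p ^ n\<close>. A set of larger measure is cut by one of them
  into a piece that is neither null nor all of it.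
\<close>

lemma nonatomic_geometric_bernoulli:
  assumes p: "1 / 2 < p" "p < 1"
  shows "nonatomic (geometric_bernoulli p)"
  unfolding nonatomic_def
proof (intro ballI impI)
  let ?M = "geometric_bernoulli p"
  interpret prob_space ?M
    by (rule prob_space_geometric_bernoulli)
  fix A assume A: "A \<in> sets ?M" "0 < emeasure ?M A"
  then have "0 < measure ?M A"
    by (simp add: emeasure_eq_measure)
  then obtain n where n: "p ^ n < measure ?M A"
    using real_arch_pow_inv p(2) by blast
  have small: "measure ?M C \<le> p ^ n" "C \<in> sets ?M" if C: "C \<in> cylinders_from n" for C
  proof -
    obtain v es w where es: "C = cylinder v es" "finite_path v es w" "n \<le> length es"
      using C by (auto simp: cylinders_from_iff)
    have "cylinder_mass p (length es) w \<le> 1 * 1 * p ^ length es"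
      unfolding cylinder_mass_def using p
      by (intro mult_mono power_le_one mult_nonneg_nonneg zero_le_power) (auto simp: field_simps)
    also have "\<dots> \<le> p ^ n"
      using p es(3) by (simp add: power_decreasing)
    finally show "measure ?M C \<le> p ^ n"
      using measure_geometric_bernoulli[OF p es(2)] es(1) by simp
    show "C \<in> sets ?M"
      using es cylinder_in_path_measure[of ?M] by simp
  qed
  have "\<exists>C \<in> cylinders_from n. emeasure ?M (A \<inter> C) \<noteq> 0"
  proof (rule ccontr)
    assume "\<not> ?thesis"
    then have "(\<Union>C \<in> cylinders_from n. A \<inter> C) \<in> null_sets ?M"
      using A small(2) by (intro null_sets_UN' countable_cylinders_from null_setsI) auto
    moreover have "A \<subseteq> path_space"
      using sets.sets_into_space[OF A(1)] by simp
    then have "(\<Union>C \<in> cylinders_from n. A \<inter> C) = A"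
      using cylinders_from_cover[of n] by blast
    ultimately show False
      using A(2) by auto
  qed
  then obtain C where C: "C \<in> cylinders_from n" "emeasure ?M (A \<inter> C) \<noteq> 0"
    by blast
  have "measure ?M (A \<inter> C) \<le> measure ?M C"
    using small(2)[OF C(1)] by (intro finite_measure_mono) auto
  also have "\<dots> < measure ?M A"
    using small(1)[OF C(1)] n by simp
  finally have "emeasure ?M (A \<inter> C) < emeasure ?M A"
    by (simp add: emeasure_eq_measure ennreal_less_iff)
  moreover have "A \<inter> C \<in> sets ?M"
    using A(1) small(2)[OF C(1)] by blast
  ultimately show "\<exists>B\<in>sets ?M. B \<subseteq> A \<and> 0 < emeasure ?M B \<and> emeasure ?M B < emeasure ?M A"
    using C(2) by (intro bexI[of _ "A \<inter> C"]) (auto simp: zero_less_iff_neq_zero)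
qed

text \<open>
  The conditional probabilities of an invariant set given a cylinder form a bounded harmonic function,
  so they have a constant value \<open>c\<close>: the set is independent of every measurable set, in particular
  of its own complement.
\<close>

lemma tail_ergodic_geometric_bernoulli:
  assumes p: "1 / 2 < p" "p < 1"
  shows "tail_ergodic (geometric_bernoulli p)"
  unfolding tail_ergodic_def
proof (intro ballI impI)
  let ?M = "geometric_bernoulli p"
  interpret prob_space ?M
    by (rule prob_space_geometric_bernoulli)
  note M = sets_geometric_bernoulli[of p] finite_measure_axioms tail_invariant_geometric_bernoulli[OF p]
  fix A assume A: "A \<in> sets ?M" "tail_rel `` A = A"
  define u where "u n k = measure ?M (A \<inter> vertical_cylinder n (Suc k)) / cylinder_mass p n (Suc k)" for n k
  have pos: "0 < cylinder_mass p n w" for n w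
    by (rule cylinder_mass_pos[OF p])
  have const: "u n k = u 0 0" for n k
  proof (rule bounded_harmonic_constant[of p])
    fix n k
    have "cylinder_mass p (Suc n) (Suc k) = p * cylinder_mass p n (Suc k)"
      "cylinder_mass p (Suc n) (Suc (Suc k)) = (1 - p) * cylinder_mass p n (Suc k)"
      using p by (simp_all add: cylinder_mass_def)
    then have "p * u (Suc n) k + (1 - p) * u (Suc n) (Suc k)
        = (measure ?M (A \<inter> vertical_cylinder (Suc n) (Suc k)) +
           measure ?M (A \<inter> vertical_cylinder (Suc n) (Suc (Suc k)))) / cylinder_mass p n (Suc k)"
      using p by (simp add: u_def add_divide_distrib)
    then show "u n k = p * u (Suc n) k + (1 - p) * u (Suc n) (Suc k)"
      using measure_invariant_harmonic[OF M A, of "Suc k" n] by (simp add: u_def)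
    show "0 \<le> u n k"
      using pos[of n "Suc k"] by (simp add: u_def)
    have "finite_path (Suc k) (replicate n (Suc k, Suc k)) (Suc k)"
      by (rule finite_path_vertical) simp
    then have v: "measure ?M (vertical_cylinder n (Suc k)) = cylinder_mass p n (Suc k)"
      and "vertical_cylinder n (Suc k) \<in> sets ?M"
      using measure_geometric_bernoulli[OF p] cylinder_in_path_measure[OF M(1)]
      by (fastforce simp: vertical_cylinder_def)+
    then have "measure ?M (A \<inter> vertical_cylinder n (Suc k)) \<le> cylinder_mass p n (Suc k)"
      unfolding v[symmetric] by (intro finite_measure_mono) auto
    then show "u n k \<le> 1"
      using pos[of n "Suc k"] by (simp add: u_def)
  qed (use p in auto)
  define c where "c = u 0 0"
  have c: "0 \<le> c"
    using pos[of 0 "Suc 0"] by (simp add: c_def u_def)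
  have "density ?M (indicator A) = scale_measure (ennreal c) ?M"
  proof (rule path_measure_eqI[where n = 0])
    fix v es w assume es: "finite_path v es w"
    have C: "cylinder v es \<in> sets ?M"
      by (rule cylinder_in_path_measure[OF M(1) es])
    obtain k where k: "w = Suc k"
      using finite_path_range_ge1[OF es] by (cases w) auto
    have "measure ?M (A \<inter> cylinder v es) = c * measure ?M (cylinder v es)"
      using measure_invariant_Int_cylinder[OF M A es] const[of "length es" k] pos[of "length es" w]
      by (simp add: measure_geometric_bernoulli[OF p es] u_def c_def k field_simps)
    then show "emeasure (density ?M (indicator A)) (cylinder v es)
        = emeasure (scale_measure (ennreal c) ?M) (cylinder v es)"
      unfolding emeasure_restricted[OF A(1) C] using c by (simp add: emeasure_eq_measure ennreal_mult)
    show "emeasure (density ?M (indicator A)) (cylinder v es) \<noteq> \<infinity>"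
      unfolding emeasure_restricted[OF A(1) C] by simp
  qed simp_all
  then have eq: "emeasure ?M (A \<inter> B) = ennreal c * emeasure ?M B" if "B \<in> sets ?M" for B
    using emeasure_restricted[OF A(1) that] by (metis emeasure_scale_measure)
  have "A \<inter> (space ?M - A) = {}" "A \<inter> space ?M = A"
    using sets.sets_into_space[OF A(1)] by blast+
  then have "ennreal c * emeasure ?M (space ?M - A) = 0" "emeasure ?M A = ennreal c * emeasure ?M (space ?M)"
    using eq[OF sets.Diff[OF sets.top A(1)]] eq[OF sets.top] by simp_all
  then show "emeasure ?M A = 0 \<or> emeasure ?M (space ?M - A) = 0"
    by auto
qed

lemma geometric_bernoulli_ergodic_invariant:
  "1 / 2 < p \<Longrightarrow> p < 1 \<Longrightarrow> geometric_bernoulli p \<in> ergodic_invariant_probs"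
  by (simp add: ergodic_invariant_probs_def prob_space_geometric_bernoulli
    nonatomic_geometric_bernoulli tail_invariant_geometric_bernoulli tail_ergodic_geometric_bernoulli)

section \<open>The extension from the Pascal subdiagram\<close>

lemma finite_path_range_bounds:
  "finite_path i es w \<Longrightarrow> w \<in> sub_vertices i (length es)"
  using path_weight[of i es w 1]
proof (induction i es w rule: finite_path.induct)
  case (2 v e es w)
  then show ?case
    using path_weight[of "snd e" es w 1] by (auto simp: sub_vertices_def edges_def)
qed (simp add: sub_vertices_def)

text \<open>
  The vertex sets of the subdiagram are so large that no path starting at \<open>i\<close> can leave it.
\<close>

lemma sub_finite_path_iff: "sub_finite_path i es w \<longleftrightarrow> finite_path i es w"
proof -
  have "es ! k \<in> sub_edges i k" if es: "finite_path i es w" and k: "k < length es" for k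
  proof -
    have "es = take k es @ [es ! k] @ drop (Suc k) es"
      using k by (simp add: id_take_nth_drop[symmetric])
    then have path: "finite_path i (take k es @ [es ! k]) (snd (es ! k))"
      using es by (metis append_assoc finite_path_append finite_path_snoc)
    then have "finite_path i (take k es) (fst (es ! k))" "es ! k \<in> edges"
      by (simp_all add: finite_path_snoc)
    then show ?thesis
      using finite_path_range_bounds[of i "take k es"] finite_path_range_bounds[OF path] k
      by (auto simp: sub_edges_def min_def)
  qed
  then show ?thesis
    by (auto simp: sub_finite_path_def)
qed

lemma finite_path_exists:
  assumes "1 \<le> i" "w \<in> sub_vertices i n"
  obtains es where "length es = n" "finite_path i es w"
proof -
  have "\<exists>es. length es = n \<and> finite_path i es w"
    using assms(2)
  proof (induction n arbitrary: w)
    case 0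
    with assms(1) show ?case
      by (simp add: sub_vertices_def)
  next
    case (Suc n)
    show ?case
    proof (cases "w \<le> i + n")
      case True
      then obtain es where "length es = n" "finite_path i es w"
        using Suc by (auto simp: sub_vertices_def)
      then show ?thesis
        using finite_path_range_ge1[of i es w]
        by (intro exI[of _ "es @ [(w, w)]"]) (simp add: finite_path_snoc edges_def)
    next
      case False
      then have w: "w = Suc (i + n)"
        using Suc.prems by (simp add: sub_vertices_def)
      then obtain es where "length es = n" "finite_path i es (i + n)"
        using Suc.IH[of "i + n"] by (auto simp: sub_vertices_def)
      then show ?thesis
        using assms(1) w
        by (intro exI[of _ "es @ [(i + n, w)]"]) (simp add: finite_path_snoc edges_def)
    qed
  qed
  with that show ?thesis
    by blast
qed

lemma sub_vertices_absorbing: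
  assumes x: "x \<in> path_space" and n: "fst (x n) \<in> sub_vertices i n" and m: "n \<le> m"
  shows "fst (x m) \<in> sub_vertices i m"
  using m
proof (induction m rule: dec_induct)
  case (step m)
  have "x m \<in> edges" "snd (x m) = fst (x (Suc m))"
    using x by (auto simp: path_space_def)
  with step show ?case
    by (auto simp: edges_def sub_vertices_def)
qed (rule n)

text \<open>
  A path that has entered the subdiagram never leaves it. The sets on which the extension is
  prescribed are therefore ordinary cylinders.
\<close>

lemma sub_continuation_eq_cylinder:
  assumes es: "finite_path v es w" and w: "w \<in> sub_vertices i (length es)"
  shows "{x \<in> cylinder v es. \<forall>m \<ge> length es. x m \<in> sub_edges i m} = cylinder v es"
proof -
  have "x m \<in> sub_edges i m" if x: "x \<in> cylinder v es" and m: "length es \<le> m" for x m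
  proof -
    have px: "x \<in> path_space"
      using x cylinder_subset_path_space by blast
    then have "x m \<in> edges" "snd (x m) = fst (x (Suc m))"
      by (auto simp: path_space_def)
    moreover have "fst (x m) \<in> sub_vertices i m" "fst (x (Suc m)) \<in> sub_vertices i (Suc m)"
      using sub_vertices_absorbing[OF px, of "length es" i] cylinder_endpoint[OF x es] w m by simp_all
    ultimately show ?thesis
      by (auto simp: sub_edges_def)
  qed
  then show ?thesis
    by blast
qed

definition sub_entered :: "nat \<Rightarrow> nat \<Rightarrow> (nat \<Rightarrow> edge) set" where
  "sub_entered i n = {x \<in> path_space. fst (x n) \<in> sub_vertices i n}"

lemma sub_path_space_eq_cylinder: "sub_path_space i = cylinder i []"
  by (auto simp: sub_path_space_def cylinder_def)

text \<open>
  Every vertex of the subdiagram is reached from \<open>i\<close> at its level, so a path that enters the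
  subdiagram can be given an initial segment starting at \<open>i\<close>.
\<close>

lemma saturation_sub_path_space:
  assumes "1 \<le> i"
  shows "tail_rel `` sub_path_space i = (\<Union>n. sub_entered i n)"
proof
  show "tail_rel `` sub_path_space i \<subseteq> (\<Union>n. sub_entered i n)"
  proof
    fix y assume "y \<in> tail_rel `` sub_path_space i"
    then obtain x N where x: "x \<in> path_space" "fst (x 0) = i" and y: "y \<in> path_space" "x N = y N"
      by (auto simp: tail_rel_def sub_path_space_def)
    have "fst (x N) \<in> sub_vertices i N"
      using sub_vertices_absorbing[OF x(1), of 0 i N] x(2) by (simp add: sub_vertices_def)
    with y show "y \<in> (\<Union>n. sub_entered i n)"
      by (auto simp: sub_entered_def)
  qed
  show "(\<Union>n. sub_entered i n) \<subseteq> tail_rel `` sub_path_space i"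
  proof
    fix x assume "x \<in> (\<Union>n. sub_entered i n)"
    then obtain n where x: "x \<in> path_space" "fst (x n) \<in> sub_vertices i n"
      by (auto simp: sub_entered_def)
    obtain es where es: "length es = n" "finite_path i es (fst (x n))"
      by (rule finite_path_exists[OF assms x(2)])
    have same: "same_endpoint (fst (x 0)) (map x [0..<n]) i es"
      using finite_path_initial_segment[OF x(1), of n] es by (auto simp: same_endpoint_def)
    have y: "replace_prefix es x \<in> cylinder i es"
      by (rule replace_prefix_in_cylinder[OF same mem_cylinder_initial_segment[OF x(1)]])
    have "(replace_prefix es x, x) \<in> tail_rel"
      using x(1) y cylinder_subset_path_space unfolding tail_rel_def
      by (auto intro!: exI[of _ n] simp: replace_prefix_def es(1))
    moreover have "replace_prefix es x \<in> sub_path_space i"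
      using y by (simp add: cylinder_def sub_path_space_def)
    ultimately show "x \<in> tail_rel `` sub_path_space i"
      by blast
  qed
qed

lemma cylinder_vertex:
  assumes "finite_path v es w" "n \<le> length es" "x \<in> cylinder v es" "y \<in> cylinder v es"
  shows "fst (x n) = fst (y n)"
  using assms cylinder_endpoint[OF assms(3,1)] cylinder_endpoint[OF assms(4,1)]
  by (cases "n = length es") (simp_all add: cylinder_def)

lemma sub_entered_in_sets: "sub_entered i n \<in> sets path_borel"
proof -
  have "sub_entered i n = \<Union> {C \<in> cylinders_from n. C \<subseteq> sub_entered i n}"
  proof
    show "sub_entered i n \<subseteq> \<Union> {C \<in> cylinders_from n. C \<subseteq> sub_entered i n}"
    proof
      fix x assume x: "x \<in> sub_entered i n"
      then have px: "x \<in> path_space"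
        by (simp add: sub_entered_def)
      let ?es = "map x [0..<n]"
      note path = finite_path_initial_segment[OF px, of n] and mem = mem_cylinder_initial_segment[OF px, of n]
      have "cylinder (fst (x 0)) ?es \<subseteq> sub_entered i n"
      proof
        fix y assume y: "y \<in> cylinder (fst (x 0)) ?es"
        have "fst (y n) = fst (x n)"
          by (rule cylinder_vertex[OF path _ y mem]) simp
        with x y cylinder_subset_path_space show "y \<in> sub_entered i n"
          by (auto simp: sub_entered_def)
      qed
      moreover have "cylinder (fst (x 0)) ?es \<in> cylinders_from n"
        unfolding cylinders_from_iff using path by (intro exI conjI) auto
      ultimately show "x \<in> \<Union> {C \<in> cylinders_from n. C \<subseteq> sub_entered i n}"
        using mem by blast
    qed
  qed blast
  moreover have "\<Union> {C \<in> cylinders_from n. C \<subseteq> sub_entered i n} \<in> sets path_borel"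
    unfolding sets_path_borel[of n] using countable_cylinders_from[of n]
    by (intro sigma_sets_UNION) (auto intro: countable_subset)
  ultimately show ?thesis
    by simp
qed

lemma incseq_sub_entered: "incseq (sub_entered i)"
  using sub_vertices_absorbing by (auto simp: sub_entered_def incseq_def)

lemma scaled_geometric_bernoulli_cylinder:
  assumes p: "1 / 2 < p" "p < 1" and es: "finite_path v es w" and i: "1 \<le> i" "i \<le> w"
  shows "emeasure (scale_measure (ennreal (1 / cylinder_mass p 0 i)) (geometric_bernoulli p)) (cylinder v es)
    = ennreal (p ^ length es * ((1 - p) / p) ^ (w - i))"
proof -
  have "cylinder_mass p (length es) w = cylinder_mass p 0 i * (p ^ length es * ((1 - p) / p) ^ (w - i))"
  proof -
    have "w - 1 = (i - 1) + (w - i)"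
      using i by simp
    then have "((1 - p) / p) ^ (w - 1) = ((1 - p) / p) ^ (i - 1) * ((1 - p) / p) ^ (w - i)"
      by (simp add: power_add)
    then show ?thesis
      by (simp add: cylinder_mass_def)
  qed
  moreover have "0 < cylinder_mass p 0 i"
    by (rule cylinder_mass_pos[OF p])
  ultimately show ?thesis
    by (simp add: emeasure_geometric_bernoulli[OF p es] ennreal_mult'[symmetric])
qed

text \<open>
  Both measures are pushed forward to the whole path space, where cylinders with another start
  vertex receive no mass.
\<close>

lemma subspace_path_measure_eqI:
  assumes i: "1 \<le> i"
    and M: "sets M = sets (restrict_space path_borel (sub_path_space i))"
    and N: "sets N = sets (restrict_space path_borel (sub_path_space i))"
    and fin: "finite_measure M"
    and eq: "\<And>es w. finite_path i es w \<Longrightarrow> emeasure M (cylinder i es) = emeasure N (cylinder i es)"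
  shows "M = N"
proof (rule measure_eqI)
  show "sets M = sets N"
    using M N by simp
  fix A assume A: "A \<in> sets M"
  have X: "finite_path i [] i"
    using i by simp
  have space: "space L = sub_path_space i" and meas: "(\<lambda>x. x) \<in> measurable L path_borel"
    if L: "sets L = sets (restrict_space path_borel (sub_path_space i))" for L
  proof -
    show "space L = sub_path_space i"
      using sets_eq_imp_space_eq[OF L] space_restrict_cylinder[of path_borel i "[]"]
      by (simp add: sub_path_space_eq_cylinder)
    have "(\<lambda>x. x) \<in> measurable (restrict_space path_borel (sub_path_space i)) path_borel"
      by (rule measurable_restrict_space1) simp
    then show "(\<lambda>x. x) \<in> measurable L path_borel"
      using measurable_cong_sets[OF L refl] by blast
  qed
  have ext: "emeasure (distr L path_borel (\<lambda>x. x)) B = emeasure L (B \<inter> sub_path_space i)"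
    if "sets L = sets (restrict_space path_borel (sub_path_space i))" "B \<in> sets path_borel" for L B
    using emeasure_distr[OF meas[OF that(1)] that(2)] space[OF that(1)] by simp
  have "distr M path_borel (\<lambda>x. x) = distr N path_borel (\<lambda>x. x)"
  proof (rule path_measure_eqI[where n = 0])
    fix v es w assume es: "finite_path v es w"
    note sets = cylinder_in_sets[OF es]
    show "emeasure (distr M path_borel (\<lambda>x. x)) (cylinder v es) \<noteq> \<infinity>"
      using ext[OF M sets] finite_measure.emeasure_finite[OF fin] by simp
    show "emeasure (distr M path_borel (\<lambda>x. x)) (cylinder v es)
        = emeasure (distr N path_borel (\<lambda>x. x)) (cylinder v es)"
    proof (cases "v = i")
      case True
      then have "cylinder v es \<inter> sub_path_space i = cylinder i es"
        by (auto simp: sub_path_space_def cylinder_def)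
      with es True show ?thesis
        unfolding ext[OF M sets] ext[OF N sets] using eq[of es w] by simp
    next
      case False
      then have "cylinder v es \<inter> sub_path_space i = {}"
        by (auto simp: sub_path_space_def cylinder_def)
      then show ?thesis
        unfolding ext[OF M sets] ext[OF N sets] by simp
    qed
  qed simp_all
  moreover have "A \<in> sets path_borel" "A \<subseteq> sub_path_space i"
    using A X unfolding M sub_path_space_eq_cylinder by (simp_all add: sets_restrict_cylinder_iff)
  ultimately show "emeasure M A = emeasure N A"
    using ext[OF M, of A] ext[OF N, of A] by (simp add: Int_absorb2)
qed

text \<open>
  The restriction of the geometric-Bernoulli measure to the paths starting at \<open>i\<close>, divided by the
  mass of these paths, has the defining properties of \<open>nu\<close>.
\<close>

lemma emeasure_nu:
  assumes i: "1 \<le> i" and p: "1 / 2 < p" "p < 1" and es: "finite_path i es w"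
  shows "emeasure (nu i p) (cylinder i es) = ennreal (p ^ length es * ((1 - p) / p) ^ (w - i))"
proof -
  let ?K = "scale_measure (ennreal (1 / cylinder_mass p 0 i)) (geometric_bernoulli p)"
  let ?R = "restrict_space ?K (sub_path_space i)"
  let ?P = "\<lambda>M. sets M = sets (restrict_space path_borel (sub_path_space i)) \<and> prob_space M \<and>
     (\<forall>es w. sub_finite_path i es w \<longrightarrow>
        emeasure M (cylinder i es) = ennreal (prod_list (map (edge_weight p) es)))"
  have X: "finite_path i [] i"
    using i by simp
  have K: "sets ?K = sets path_borel"
    by simp
  have R: "emeasure ?R A = emeasure ?K A" if "A \<subseteq> sub_path_space i" for A
  proof (rule emeasure_restrict_space[OF _ that])
    show "sub_path_space i \<inter> space ?K \<in> sets ?K"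
      unfolding sub_path_space_eq_cylinder
      using cylinder_in_path_measure[OF K X] by (intro sets.Int sets.top)
  qed
  have sub: "cylinder i es \<subseteq> sub_path_space i" for es
    by (auto simp: cylinder_def sub_path_space_def)
  have "?P ?R"
  proof (intro conjI allI impI)
    show "sets ?R = sets (restrict_space path_borel (sub_path_space i))"
      by (rule sets_restrict_space_cong) simp
    have "space ?R = sub_path_space i"
      unfolding sub_path_space_eq_cylinder by (rule space_restrict_cylinder[OF K])
    then have "emeasure ?R (space ?R) = emeasure ?K (cylinder i [])"
      using R[OF subset_refl] by (simp add: sub_path_space_eq_cylinder)
    then show "prob_space ?R"
      using scaled_geometric_bernoulli_cylinder[OF p X i order_refl] by (intro prob_spaceI) simp
    fix es w assume "sub_finite_path i es w"
    then have es: "finite_path i es w"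
      by (simp add: sub_finite_path_iff)
    then show "emeasure ?R (cylinder i es) = ennreal (prod_list (map (edge_weight p) es))"
      using R[OF sub] scaled_geometric_bernoulli_cylinder[OF p es i] path_weight[OF es, of p] p by simp
  qed
  moreover have "M = ?R" if M: "?P M" for M
  proof (rule subspace_path_measure_eqI[OF i])
    show "finite_measure M"
      using M by (simp add: prob_space.finite_measure)
    fix es w assume "finite_path i es w"
    then have es: "sub_finite_path i es w"
      by (simp add: sub_finite_path_iff)
    have "emeasure L (cylinder i es) = ennreal (prod_list (map (edge_weight p) es))" if "?P L" for L
      using that es by blast
    from this[OF M] this[OF \<open>?P ?R\<close>] show "emeasure M (cylinder i es) = emeasure ?R (cylinder i es)"
      by (rule trans[OF _ sym])
  qed (use M \<open>?P ?R\<close> in simp_all)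
  ultimately have "nu i p = ?R"
    unfolding nu_def by (rule the_equality)
  then show ?thesis
    using R[OF sub] scaled_geometric_bernoulli_cylinder[OF p es i] path_weight[OF es, of p] p by simp
qed

text \<open>
  The specification of \<open>nu_hat\<close>, named so that existence and uniqueness can be shown separately.
\<close>

definition extends_nu :: "nat \<Rightarrow> real \<Rightarrow> (nat \<Rightarrow> edge) measure \<Rightarrow> bool" where
  "extends_nu i p M \<longleftrightarrow> sets M = sets path_borel \<and> tail_invariant M \<and>
     (\<forall>v es' w es. finite_path v es' w \<and> w \<in> sub_vertices i (length es') \<and>
        sub_finite_path i es w \<and> length es = length es' \<longrightarrow>
        emeasure M {x \<in> cylinder v es'. \<forall>m \<ge> length es'. x m \<in> sub_edges i m} =
          emeasure (nu i p) (cylinder i es)) \<and>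
     emeasure M (path_space - tail_rel `` sub_path_space i) = 0"

lemma extends_nu_sets: "extends_nu i p M \<Longrightarrow> sets M = sets path_borel"
  by (simp add: extends_nu_def)

lemma extends_nu_cylinder:
  assumes "extends_nu i p M" "finite_path v es' w" "w \<in> sub_vertices i (length es')"
    and "finite_path i es w" "length es = length es'"
  shows "emeasure M (cylinder v es') = emeasure (nu i p) (cylinder i es)"
proof -
  have "emeasure M {x \<in> cylinder v es'. \<forall>m \<ge> length es'. x m \<in> sub_edges i m}
      = emeasure (nu i p) (cylinder i es)"
    using assms unfolding extends_nu_def sub_finite_path_iff by blast
  then show ?thesis
    unfolding sub_continuation_eq_cylinder[OF assms(2,3)] .
qed

lemma saturation_in_sets: "1 \<le> i \<Longrightarrow> tail_rel `` sub_path_space i \<in> sets path_borel"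
  unfolding saturation_sub_path_space using sub_entered_in_sets by blast

text \<open>
  The saturation is an invariant set that contains the paths starting at \<open>i\<close>, hence it is not null,
  and ergodicity applies.
\<close>

lemma geometric_bernoulli_saturation:
  assumes i: "1 \<le> i" and p: "1 / 2 < p" "p < 1"
  shows "emeasure (geometric_bernoulli p) (path_space - tail_rel `` sub_path_space i) = 0"
proof -
  let ?G = "geometric_bernoulli p" and ?S = "tail_rel `` sub_path_space i"
  have X: "finite_path i [] i"
    using i by simp
  have "sub_path_space i \<subseteq> sub_entered i 0"
    by (auto simp: sub_entered_def sub_path_space_def sub_vertices_def)
  then have "cylinder i [] \<subseteq> ?S"
    using saturation_sub_path_space[OF i] sub_path_space_eq_cylinder[of i] by blast
  then have "emeasure ?G (cylinder i []) \<le> emeasure ?G ?S"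
    using saturation_in_sets[OF i] by (intro emeasure_mono) simp_all
  then have "emeasure ?G ?S \<noteq> 0"
    using emeasure_geometric_bernoulli[OF p X] cylinder_mass_pos[OF p, of 0 i] by auto
  moreover have "emeasure ?G ?S = 0 \<or> emeasure ?G (space ?G - ?S) = 0"
    using tail_ergodic_geometric_bernoulli[OF p] saturation_in_sets[OF i]
      tail_saturation_idem[of "sub_path_space i"]
    unfolding tail_ergodic_def sets_geometric_bernoulli by blast
  ultimately show ?thesis
    by simp
qed

lemma extends_nu_geometric_bernoulli:
  assumes i: "1 \<le> i" and p: "1 / 2 < p" "p < 1"
  shows "extends_nu i p (scale_measure (ennreal (1 / cylinder_mass p 0 i)) (geometric_bernoulli p))"
    (is "extends_nu i p ?K")
  unfolding extends_nu_def
proof (intro conjI allI impI)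
  show "tail_invariant ?K"
    using tail_invariant_geometric_bernoulli[OF p] by (simp add: tail_invariant_def)
  show "emeasure ?K (path_space - tail_rel `` sub_path_space i) = 0"
    using geometric_bernoulli_saturation[OF assms] by simp
  fix v es' w es
  assume asm: "finite_path v es' w \<and> w \<in> sub_vertices i (length es') \<and>
      sub_finite_path i es w \<and> length es = length es'"
  then have es': "finite_path v es' w" and w: "w \<in> sub_vertices i (length es')"
    and es: "finite_path i es w" and len: "length es = length es'"
    by (simp_all add: sub_finite_path_iff)
  have "i \<le> w"
    using w by (simp add: sub_vertices_def)
  show "emeasure ?K {x \<in> cylinder v es'. \<forall>m \<ge> length es'. x m \<in> sub_edges i m}
      = emeasure (nu i p) (cylinder i es)"
    unfolding sub_continuation_eq_cylinder[OF es' w]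
      scaled_geometric_bernoulli_cylinder[OF p es' i \<open>i \<le> w\<close>] emeasure_nu[OF i p es] len ..
qed simp

text \<open>
  A cylinder of length at least \<open>n\<close> is either disjoint from the paths that are inside the subdiagram
  at level \<open>n\<close>, or it ends inside the subdiagram; in the latter case its mass is prescribed.
\<close>

lemma extends_nu_eq_on_sub_entered:
  assumes i: "1 \<le> i" and M: "extends_nu i p M" and K: "extends_nu i p K"
    and fin: "finite_measure K" and A: "A \<in> sets path_borel"
  shows "emeasure M (sub_entered i n \<inter> A) = emeasure K (sub_entered i n \<inter> A)"
proof -
  let ?E = "sub_entered i n"
  note sets = extends_nu_sets[OF M] extends_nu_sets[OF K]
  have E: "?E \<in> sets M" "?E \<in> sets K"
    using sets sub_entered_in_sets by simp_all
  have "density M (indicator ?E) = density K (indicator ?E)"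
  proof (rule path_measure_eqI[where n = n])
    fix v es w assume es: "finite_path v es w" "n \<le> length es"
    have C: "cylinder v es \<in> sets M" "cylinder v es \<in> sets K"
      using sets cylinder_in_sets[OF es(1)] by simp_all
    have eq: "emeasure M (?E \<inter> cylinder v es) = emeasure K (?E \<inter> cylinder v es)"
    proof (cases "?E \<inter> cylinder v es = {}")
      case False
      then obtain x where x: "x \<in> cylinder v es" "x \<in> path_space" "fst (x n) \<in> sub_vertices i n"
        by (auto simp: sub_entered_def)
      have "y \<in> ?E" if y: "y \<in> cylinder v es" for y
        using cylinder_vertex[OF es y x(1)] x(3) y cylinder_subset_path_space
        by (auto simp: sub_entered_def)
      then have sub: "?E \<inter> cylinder v es = cylinder v es"
        by blast
      have w: "w \<in> sub_vertices i (length es)"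
        using sub_vertices_absorbing[OF x(2,3) es(2)] cylinder_endpoint[OF x(1) es(1)] by simp
      obtain gs where gs: "length gs = length es" "finite_path i gs w"
        by (rule finite_path_exists[OF i w])
      show ?thesis
        unfolding sub extends_nu_cylinder[OF M es(1) w gs(2,1)]
          extends_nu_cylinder[OF K es(1) w gs(2,1)] ..
    qed simp
    show "emeasure (density M (indicator ?E)) (cylinder v es)
        = emeasure (density K (indicator ?E)) (cylinder v es)"
      unfolding emeasure_restricted[OF E(1) C(1)] emeasure_restricted[OF E(2) C(2)] by (rule eq)
    show "emeasure (density M (indicator ?E)) (cylinder v es) \<noteq> \<infinity>"
      unfolding emeasure_restricted[OF E(1) C(1)] eq
      using finite_measure.emeasure_finite[OF fin] by simp
  qed (simp_all add: sets)
  then show ?thesis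
    using emeasure_restricted[OF E(1), of A] emeasure_restricted[OF E(2), of A] A sets by simp
qed

lemma extends_nu_SUP:
  assumes i: "1 \<le> i" and M: "extends_nu i p M" and A: "A \<in> sets path_borel"
  shows "emeasure M A = (SUP n. emeasure M (sub_entered i n \<inter> A))"
proof -
  let ?S = "tail_rel `` sub_path_space i"
  note sets = extends_nu_sets[OF M]
  have "A \<subseteq> path_space"
    using sets.sets_into_space[OF A] by simp
  then have "A - (path_space - ?S) = (\<Union>n. sub_entered i n \<inter> A)"
    unfolding saturation_sub_path_space[OF i] by blast
  moreover have "emeasure M (path_space - ?S) = 0"
    using M by (simp add: extends_nu_def)
  then have "path_space - ?S \<in> null_sets M"
    using sets sets.compl_sets[OF saturation_in_sets[OF i]] by (intro null_setsI) simp_all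
  then have "emeasure M (A - (path_space - ?S)) = emeasure M A"
    using A sets by (intro emeasure_Diff_null_set) simp_all
  moreover have "(SUP n. emeasure M (sub_entered i n \<inter> A)) = emeasure M (\<Union>n. sub_entered i n \<inter> A)"
  proof (rule SUP_emeasure_incseq)
    show "range (\<lambda>n. sub_entered i n \<inter> A) \<subseteq> sets M"
      using A sets sub_entered_in_sets by auto
    show "incseq (\<lambda>n. sub_entered i n \<inter> A)"
      using incseq_sub_entered[of i] unfolding incseq_def by blast
  qed
  ultimately show ?thesis
    by simp
qed

text \<open>
  The scaling factor is the one that gives mass 1 to the paths starting at \<open>i\<close>.
\<close>

lemma nu_hat_eq:
  assumes i: "1 \<le> i" and p: "1 / 2 < p" "p < 1"
  shows "nu_hat i p = scale_measure (ennreal (1 / cylinder_mass p 0 i)) (geometric_bernoulli p)"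
    (is "_ = ?K")
proof -
  interpret G: prob_space "geometric_bernoulli p"
    by (rule prob_space_geometric_bernoulli)
  have K: "extends_nu i p ?K"
    by (rule extends_nu_geometric_bernoulli[OF assms])
  have fin: "finite_measure ?K"
    by (rule finite_measureI) (simp add: ennreal_mult_eq_top_iff)
  have "M = ?K" if M: "extends_nu i p M" for M
  proof (rule measure_eqI)
    show "sets M = sets ?K"
      using extends_nu_sets[OF M] by simp
    fix A assume "A \<in> sets M"
    then have A: "A \<in> sets path_borel"
      using extends_nu_sets[OF M] by simp
    show "emeasure M A = emeasure ?K A"
      unfolding extends_nu_SUP[OF i M A] extends_nu_SUP[OF i K A]
        extends_nu_eq_on_sub_entered[OF i M K fin A] ..
  qed
  with K have "(THE M. extends_nu i p M) = ?K"
    by (rule the_equality)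
  then show ?thesis
    unfolding extends_nu_def nu_hat_def .
qed

lemma normalized_nu_hat:
  assumes "1 \<le> i" "1 / 2 < p" "p < 1"
  shows "normalized (nu_hat i p) = geometric_bernoulli p"
proof -
  interpret prob_space "geometric_bernoulli p"
    by (rule prob_space_geometric_bernoulli)
  have a: "0 < 1 / cylinder_mass p 0 i"
    using cylinder_mass_pos[OF assms(2,3), of 0 i] by simp
  then have "inverse (ennreal (1 / cylinder_mass p 0 i)) * ennreal (1 / cylinder_mass p 0 i) = 1"
    by (simp add: inverse_ennreal ennreal_mult'[symmetric])
  then show ?thesis
    using emeasure_space_1
    by (simp add: normalized_def nu_hat_eq[OF assms] space_scale_measure)
qed

section \<open>Classification of the ergodic measures\<close>

text \<open>
  In terms of the start vertex and the sequence of steps, this keeps the start vertex and deletes the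
  first step. After a diagonal first step the remaining vertices have to be lowered by one for this.
\<close>

definition drop_step :: "(nat \<Rightarrow> edge) \<Rightarrow> nat \<Rightarrow> edge" where
  "drop_step x = (if snd (x 0) = fst (x 0) then (\<lambda>n. x (Suc n))
    else (\<lambda>n. (fst (x (Suc n)) - 1, snd (x (Suc n)) - 1)))"

definition raise_edge :: "edge \<Rightarrow> edge" where
  "raise_edge e = (Suc (fst e), Suc (snd e))"

lemma finite_path_raise:
  "finite_path v es w \<Longrightarrow> finite_path (Suc v) (map raise_edge es) (Suc w)"
  by (induction v es w rule: finite_path.induct) (auto simp: raise_edge_def edges_def)

lemma path_vertices_mono:
  assumes x: "x \<in> path_space" and "m \<le> n"
  shows "fst (x m) \<le> fst (x n)"
  using \<open>m \<le> n\<close>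
proof (induction n rule: dec_induct)
  case (step n)
  have "x n \<in> edges" "snd (x n) = fst (x (Suc n))"
    using x by (auto simp: path_space_def)
  with step show ?case
    by (auto simp: edges_def)
qed simp

lemma cylinder_first_edge: "x \<in> cylinder v (e # es) \<Longrightarrow> x 0 = e"
  by (simp add: cylinder_def All_less_Suc2)

lemma drop_step_cylinder:
  assumes x: "x \<in> path_space"
  shows "drop_step x \<in> cylinder v es \<longleftrightarrow>
    x \<in> cylinder v ((v, v) # es) \<or> x \<in> cylinder v ((v, Suc v) # map raise_edge es)"
proof (cases "snd (x 0) = fst (x 0)")
  case True
  have "drop_step x \<in> cylinder v es \<longleftrightarrow> fst (x 0) = v \<and> (\<forall>k<length es. x (Suc k) = es ! k)"
    using x True by (auto simp: drop_step_def cylinder_def path_space_def)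
  then show ?thesis
    using x True by (auto simp: cylinder_def All_less_Suc2 prod_eq_iff)
next
  case False
  have px: "x n \<in> edges" "snd (x n) = fst (x (Suc n))" for n
    using x by (auto simp: path_space_def)
  have diag: "snd (x 0) = Suc (fst (x 0))" "1 \<le> fst (x 0)"
    using px(1)[of 0] False by (auto simp: edges_def)
  then have ge2: "2 \<le> fst (x (Suc n))" for n
    using path_vertices_mono[OF x, of "Suc 0" "Suc n"] px(2)[of 0] by simp
  have lower: "drop_step x n = (fst (x (Suc n)) - 1, snd (x (Suc n)) - 1)" for n
    using False by (simp add: drop_step_def)
  have edge: "drop_step x n \<in> edges" for n
    using px(1)[of "Suc n"] ge2[of n] unfolding lower by (auto simp: edges_def)
  have path: "drop_step x \<in> path_space"
    unfolding path_space_def using edge px(2) by (simp add: lower)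
  have raise: "drop_step x n = e \<longleftrightarrow> x (Suc n) = raise_edge e" for n e
    using ge2[of n] px(1)[of "Suc n"] unfolding lower by (auto simp: raise_edge_def prod_eq_iff edges_def)
  have "fst (drop_step x 0) = fst (x 0)"
    using px(2)[of 0] diag by (simp add: lower)
  then have "drop_step x \<in> cylinder v es \<longleftrightarrow>
      fst (x 0) = v \<and> (\<forall>k<length es. x (Suc k) = map raise_edge es ! k)"
    using path raise by (auto simp: cylinder_def)
  then show ?thesis
    using x diag by (auto simp: cylinder_def All_less_Suc2 prod_eq_iff)
qed

lemma drop_step_paths:
  assumes "finite_path v es w"
  shows "finite_path v ((v, v) # es) w" "finite_path v ((v, Suc v) # map raise_edge es) (Suc w)"
  using assms finite_path_source_ge1[OF assms] finite_path_raise[OF assms]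
  by (simp_all add: edges_def)

lemma drop_step_in_path_space: "x \<in> path_space \<Longrightarrow> drop_step x \<in> path_space"
proof -
  assume x: "x \<in> path_space"
  have "x 0 \<in> edges"
    using x by (simp add: path_space_def)
  then have "x \<in> cylinder (fst (x 0)) [(fst (x 0), fst (x 0))] \<or>
      x \<in> cylinder (fst (x 0)) [(fst (x 0), Suc (fst (x 0)))]"
    using x by (auto simp: cylinder_def edges_def prod_eq_iff)
  then have "drop_step x \<in> cylinder (fst (x 0)) []"
    using drop_step_cylinder[OF x, of "fst (x 0)" "[]"] by simp
  then show ?thesis
    using cylinder_subset_path_space by blast
qed

lemma measurable_drop_step:
  assumes M: "sets M = sets path_borel"
  shows "drop_step \<in> measurable M path_borel"
proof (rule measurable_path_borelI[where n = 0])
  note space = path_measure_space[OF M]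
  show "drop_step x \<in> path_space" if "x \<in> space M" for x
    using that drop_step_in_path_space space by simp
  fix v es w assume es: "finite_path v es w"
  have "drop_step -` cylinder v es \<inter> space M
      = cylinder v ((v, v) # es) \<union> cylinder v ((v, Suc v) # map raise_edge es)"
    unfolding space using drop_step_cylinder cylinder_subset_path_space by blast
  then show "drop_step -` cylinder v es \<inter> space M \<in> sets M"
    using cylinder_in_path_measure[OF M drop_step_paths(1)[OF es]]
      cylinder_in_path_measure[OF M drop_step_paths(2)[OF es]] by simp
qed

text \<open>
  The preimage of a cylinder consists of two cylinders that are one edge longer, one for each possible
  first step. Their ends are the two successors of the end of the given cylinder, so that by tail
  invariance their masses add up to its mass.
\<close>

lemma distr_drop_step:
  assumes M: "sets M = sets path_borel" "finite_measure M" "tail_invariant M"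
  shows "distr M path_borel drop_step = M"
proof (rule path_measure_eqI[where n = 0])
  fix v es w assume es: "finite_path v es w"
  note paths = drop_step_paths[OF es]
  have "drop_step -` cylinder v es \<inter> space M
      = cylinder v ((v, v) # es) \<union> cylinder v ((v, Suc v) # map raise_edge es)"
    unfolding path_measure_space[OF M(1)] using drop_step_cylinder cylinder_subset_path_space by blast
  moreover have "cylinder v ((v, v) # es) \<inter> cylinder v ((v, Suc v) # map raise_edge es) = {}"
    by (fastforce dest: cylinder_first_edge)
  moreover have "cylinder v ((v, v) # es) \<in> sets M"
      "cylinder v ((v, Suc v) # map raise_edge es) \<in> sets M"
    using cylinder_in_path_measure[OF M(1)] paths by blast+
  ultimately have "emeasure M (drop_step -` cylinder v es \<inter> space M)
      = emeasure M (cylinder v ((v, v) # es)) + emeasure M (cylinder v ((v, Suc v) # map raise_edge es))"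
    by (simp add: plus_emeasure)
  also have "\<dots> = emeasure M (cylinder v es)"
    using measure_cylinder_vertical[OF M paths(1)] measure_cylinder_vertical[OF M paths(2)]
      measure_cylinder_vertical[OF M es] measure_vertical_cylinder_harmonic[OF M finite_path_range_ge1[OF es], of "length es"]
    by (simp add: finite_measure.emeasure_eq_measure[OF M(2)])
  finally have eq: "emeasure M (drop_step -` cylinder v es \<inter> space M) = emeasure M (cylinder v es)" .
  show "emeasure (distr M path_borel drop_step) (cylinder v es) = emeasure M (cylinder v es)"
    using emeasure_distr[OF measurable_drop_step[OF M(1)] cylinder_in_sets[OF es]] eq by simp
  then show "emeasure (distr M path_borel drop_step) (cylinder v es) \<noteq> \<infinity>"
    using finite_measure.emeasure_finite[OF M(2)] by simp
qed (use M in simp_all)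

definition vertical_start :: "(nat \<Rightarrow> edge) set" where
  "vertical_start = {x \<in> path_space. snd (x 0) = fst (x 0)}"

lemma vertical_start_in_sets: "vertical_start \<in> sets path_borel"
proof -
  have "x \<in> cylinder (Suc (fst (x 0) - 1)) [(Suc (fst (x 0) - 1), Suc (fst (x 0) - 1))]"
    if x: "x \<in> vertical_start" for x
  proof -
    have "x 0 \<in> edges"
      using x by (simp add: vertical_start_def path_space_def)
    with x show ?thesis
      by (auto simp: vertical_start_def cylinder_def edges_def prod_eq_iff)
  qed
  then have "vertical_start \<subseteq> (\<Union>k. cylinder (Suc k) [(Suc k, Suc k)])"
    by blast
  moreover have "(\<Union>k. cylinder (Suc k) [(Suc k, Suc k)]) \<subseteq> vertical_start"
    by (auto simp: vertical_start_def cylinder_def)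
  ultimately have "vertical_start = (\<Union>k. cylinder (Suc k) [(Suc k, Suc k)])"
    by (rule equalityI)
  moreover have "cylinder (Suc k) [(Suc k, Suc k)] \<in> sets path_borel" for k
    by (rule cylinder_in_sets[of _ _ "Suc k"]) (simp add: edges_def)
  then have "(\<Union>k. cylinder (Suc k) [(Suc k, Suc k)]) \<in> sets path_borel"
    by (intro sets.countable_UN) blast
  ultimately show ?thesis
    by simp
qed

text \<open>
  Restricting \<open>M\<close> to the paths with a vertical first step and deleting this step gives an invariant
  measure \<open>N\<close> whose mass at an end on level \<open>n\<close> is that of \<open>M\<close> at the same vertex one level later.
  As \<open>drop_step\<close> preserves \<open>M\<close>, the measure \<open>N\<close> is below \<open>M\<close>, hence a multiple of it.
\<close>

lemma ergodic_level_ratio: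
  assumes M: "sets M = sets path_borel" "prob_space M" "tail_invariant M" "tail_ergodic M"
  shows "\<exists>c. 0 \<le> c \<and> c \<le> 1 \<and>
    (\<forall>n w. 1 \<le> w \<longrightarrow> measure M (vertical_cylinder (Suc n) w) = c * measure M (vertical_cylinder n w))"
proof -
  interpret prob_space M by (rule M)
  let ?V = "vertical_start"
  have V: "?V \<in> sets M"
    using vertical_start_in_sets M(1) by simp
  note space = path_measure_space[OF M(1)]
  define N where "N = distr (density M (indicator ?V)) path_borel drop_step"
  have meas: "drop_step \<in> measurable (density M (indicator ?V)) path_borel"
    by (rule measurable_drop_step) (simp add: M)
  have pre: "drop_step -` B \<inter> space M \<in> sets M" if "B \<in> sets path_borel" for B
    using measurable_sets[OF measurable_drop_step[OF M(1)] that] .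
  have N_emeasure: "emeasure N B = emeasure M (?V \<inter> (drop_step -` B \<inter> space M))" if "B \<in> sets path_borel" for B
    unfolding N_def emeasure_distr[OF meas that] using emeasure_restricted[OF V pre[OF that]] by simp
  have N_cylinder: "emeasure N (cylinder v es) = emeasure M (cylinder v ((v, v) # es))"
    if es: "finite_path v es w" for v es w
  proof -
    have "?V \<inter> (drop_step -` cylinder v es \<inter> space M) = cylinder v ((v, v) # es)"
    proof -
      have "x \<in> ?V \<longleftrightarrow> x \<notin> cylinder v ((v, Suc v) # map raise_edge es)"
        if "x \<in> path_space" "drop_step x \<in> cylinder v es" for x
        using that drop_step_cylinder[OF that(1), of v es]
        by (auto simp: vertical_start_def cylinder_def)
      moreover have "x \<in> ?V" if "x \<in> cylinder v ((v, v) # es)" for x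
        using that by (auto simp: vertical_start_def cylinder_def)
      ultimately show ?thesis
        unfolding space using drop_step_cylinder cylinder_subset_path_space by blast
    qed
    then show ?thesis
      using N_emeasure[OF cylinder_in_sets[OF es]] by simp
  qed
  have N_inv: "tail_invariant N"
    unfolding tail_invariant_def
  proof (intro allI impI, elim conjE)
    fix v es v' es' w
    assume es: "finite_path v es w" "finite_path v' es' w" "length es = length es'"
    have "length ((v, v) # es) = length ((v', v') # es')"
      using es(3) by simp
    then show "emeasure N (cylinder v es) = emeasure N (cylinder v' es')"
      unfolding N_cylinder[OF es(1)] N_cylinder[OF es(2)]
      using M(3) drop_step_paths(1)[OF es(1)] drop_step_paths(1)[OF es(2)]
      unfolding tail_invariant_def by blast
  qed
  have dom: "emeasure N A \<le> emeasure M A" if A: "A \<in> sets M" for A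
  proof -
    have A': "A \<in> sets path_borel"
      using A M(1) by simp
    have "emeasure N A \<le> emeasure M (drop_step -` A \<inter> space M)"
      unfolding N_emeasure[OF A'] using pre[OF A'] by (intro emeasure_mono) auto
    also have "\<dots> = emeasure M A"
      using emeasure_distr[OF measurable_drop_step[OF M(1)] A']
        distr_drop_step[OF M(1) finite_measure_axioms M(3)] by simp
    finally show ?thesis .
  qed
  have N_sets: "sets N = sets path_borel"
    by (simp add: N_def)
  have c_le: "emeasure N path_space \<le> 1"
    using dom[OF sets.top] emeasure_space_1 space by simp
  then have "emeasure N path_space \<noteq> top"
    by (auto simp: top_unique)
  then obtain c where c: "emeasure N path_space = ennreal c" "0 \<le> c"
    by (cases "emeasure N path_space") auto
  then have "c \<le> 1"
    using c_le by simp
  moreover have "measure M (vertical_cylinder (Suc n) w) = c * measure M (vertical_cylinder n w)"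
    if w: "1 \<le> w" for n w
  proof -
    let ?es = "replicate n (w, w)"
    have es: "finite_path w ?es w"
      by (rule finite_path_vertical[OF w])
    have "emeasure M (cylinder w ((w, w) # ?es)) = ennreal c * emeasure M (cylinder w ?es)"
      using ergodic_dominated_proportional[OF M N_sets N_inv dom cylinder_in_path_measure[OF M(1) es]]
      unfolding N_cylinder[OF es] c(1) by simp
    then have "ennreal (measure M (cylinder w ((w, w) # ?es))) = ennreal (c * measure M (cylinder w ?es))"
      using c(2) by (simp add: emeasure_eq_measure ennreal_mult)
    then show ?thesis
      using c(2) by (simp add: vertical_cylinder_def)
  qed
  ultimately show ?thesis
    using c(2) by blast
qed

lemma nonatomic_singleton_null:
  assumes "nonatomic M" "{x} \<in> sets M"
  shows "emeasure M {x} = 0"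
proof (rule ccontr)
  assume "emeasure M {x} \<noteq> 0"
  then obtain B where "B \<in> sets M" "B \<subseteq> {x}" "0 < emeasure M B" "emeasure M B < emeasure M {x}"
    using assms unfolding nonatomic_def by (metis zero_less_iff_neq_zero)
  moreover from \<open>B \<subseteq> {x}\<close> have "B = {} \<or> B = {x}"
    by blast
  ultimately show False
    by auto
qed

lemma vertical_cylinders_Inter: "(\<Inter>n. vertical_cylinder n w) \<subseteq> {\<lambda>_. (w, w)}"
proof
  fix x assume x: "x \<in> (\<Inter>n. vertical_cylinder n w)"
  have "x k = (w, w)" for k
  proof -
    have "x \<in> vertical_cylinder (Suc k) w"
      using x by blast
    then show ?thesis
      unfolding vertical_cylinder_def cylinder_def by (auto simp del: replicate_Suc)
  qed
  then show "x \<in> {\<lambda>_. (w, w)}"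
    by auto
qed

lemma vertical_cylinder_in_sets: "1 \<le> w \<Longrightarrow> vertical_cylinder n w \<in> sets path_borel"
  unfolding vertical_cylinder_def by (rule cylinder_in_sets[OF finite_path_vertical])

text \<open>
  Otherwise the path that is vertical forever would be an atom.
\<close>

lemma nonatomic_vertical_cylinder:
  assumes M: "sets M = sets path_borel" "prob_space M" "nonatomic M" and w: "1 \<le> w"
  shows "\<exists>n. measure M (vertical_cylinder n w) \<noteq> 1"
proof (rule ccontr)
  interpret prob_space M by (rule M)
  assume "\<not> ?thesis"
  then have one: "measure M (vertical_cylinder n w) = 1" for n
    by blast
  have sets: "vertical_cylinder n w \<in> sets M" for n
    using vertical_cylinder_in_sets[OF w] M(1) by simp
  have "AE x in M. x \<in> vertical_cylinder n w" for n
    using one sets prob_eq_1 by simp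
  then have "AE x in M. \<forall>n. x \<in> vertical_cylinder n w"
    by (simp add: AE_all_countable)
  then have ae: "AE x in M. x \<in> (\<Inter>n. vertical_cylinder n w)"
    by simp
  have Inter: "(\<Inter>n. vertical_cylinder n w) \<in> sets M"
    using sets by auto
  then have "emeasure M (\<Inter>n. vertical_cylinder n w) = 1"
    using ae emeasure_eq_1_AE by blast
  moreover have "(\<Inter>n. vertical_cylinder n w) = {} \<or> (\<Inter>n. vertical_cylinder n w) = {\<lambda>_. (w, w)}"
    using vertical_cylinders_Inter[of w] by blast
  ultimately show False
    using nonatomic_singleton_null[OF M(3)] Inter by auto
qed

lemma initial_distribution_sums:
  assumes M: "sets M = sets path_borel" "prob_space M"
  shows "(\<lambda>k. measure M (vertical_cylinder 0 (Suc k))) sums 1"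
proof -
  interpret prob_space M by (rule M)
  have "range (\<lambda>k. vertical_cylinder 0 (Suc k)) \<subseteq> sets M"
    using vertical_cylinder_in_sets M(1) by auto
  moreover have "disjoint_family (\<lambda>k. vertical_cylinder 0 (Suc k))"
    by (auto simp: disjoint_family_on_def vertical_cylinder_def cylinder_def)
  ultimately have "(\<lambda>k. measure M (vertical_cylinder 0 (Suc k))) sums
      measure M (\<Union>k. vertical_cylinder 0 (Suc k))"
    by (rule finite_measure_UNION)
  moreover have "(\<Union>k. vertical_cylinder 0 (Suc k)) = path_space"
  proof -
    have "x \<in> vertical_cylinder 0 (Suc (fst (x 0) - 1))" if x: "x \<in> path_space" for x
    proof -
      have "x 0 \<in> edges"
        using x by (simp add: path_space_def)
      with x show ?thesis
        by (auto simp: vertical_cylinder_def cylinder_def edges_def)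
    qed
    then show ?thesis
      using cylinder_subset_path_space by (fastforce simp: vertical_cylinder_def)
  qed
  ultimately show ?thesis
    using prob_space path_measure_space[OF M(1)] by simp
qed

text \<open>
  The constant ratio \<open>c\<close> of successive levels and the harmonic relation between them determine all
  cylinder masses up to a factor, which is fixed by the total mass of level 0.
\<close>

lemma ergodic_invariant_is_geometric_bernoulli:
  assumes "M \<in> ergodic_invariant_probs"
  shows "\<exists>p. 1 / 2 < p \<and> p < 1 \<and> M = geometric_bernoulli p"
proof -
  have M: "sets M = sets path_borel" "prob_space M" "tail_invariant M" "tail_ergodic M"
    and nonat: "nonatomic M"
    using assms by (simp_all add: ergodic_invariant_probs_def)
  interpret prob_space M by (rule M)
  define g where "g n w = measure M (vertical_cylinder n w)" for n w
  obtain c where c: "0 \<le> c" "c \<le> 1" and level: "\<And>n w. 1 \<le> w \<Longrightarrow> g (Suc n) w = c * g n w"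
    using ergodic_level_ratio[OF M] unfolding g_def by blast
  have harmonic: "g n w = g (Suc n) w + g (Suc n) (Suc w)" if "1 \<le> w" for n w
    using measure_vertical_cylinder_harmonic[OF M(1) finite_measure_axioms M(3) that, of n]
    by (simp add: g_def)
  have power: "g n w = c ^ n * g 0 w" if "1 \<le> w" for n w
    using level[OF that] by (induction n) simp_all
  define h where "h k = g 0 (Suc k)" for k
  have h_sums: "h sums 1"
    using initial_distribution_sums[OF M(1,2)] unfolding h_def g_def .
  have h_rec: "(1 - c) * h k = c * h (Suc k)" for k
    using harmonic[of "Suc k" 0] level[of "Suc k" 0] level[of "Suc (Suc k)" 0]
    by (simp add: h_def algebra_simps)
  have h_nonzero: "h \<noteq> (\<lambda>k. 0)"
  proof
    assume "h = (\<lambda>k. 0)"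
    with h_sums have "(\<lambda>k. 0 :: real) sums 1"
      by simp
    then show False
      using sums_unique2[OF _ sums_zero] by fastforce
  qed
  have c_pos: "0 < c"
  proof (rule ccontr)
    assume "\<not> 0 < c"
    with c have "h = (\<lambda>k. 0)"
      using h_rec by auto
    with h_nonzero show False
      by simp
  qed
  \<comment> \<open>The masses \<open>h\<close> of the start vertices form a geometric sequence with ratio \<open>r\<close>.\<close>
  define r where "r = (1 - c) / c"
  have h_power: "h k = h 0 * r ^ k" for k
  proof (induction k)
    case (Suc k)
    have "h (Suc k) = r * h k"
      using h_rec[of k] c_pos by (simp add: r_def field_simps)
    with Suc show ?case
      by simp
  qed simp
  then have h_fun: "h = (\<lambda>k. h 0 * r ^ k)"
    by (rule ext)
  have h0: "h 0 \<noteq> 0"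
  proof
    assume "h 0 = 0"
    with h_fun have "h = (\<lambda>k. 0)"
      by simp
    with h_nonzero show False
      by simp
  qed
  have r_nonneg: "0 \<le> r"
    using c c_pos by (simp add: r_def)
  have "summable (\<lambda>k. h 0 * r ^ k)"
    using h_sums h_fun sums_summable by metis
  then have "summable (\<lambda>k. r ^ k)"
    using h0 by (simp add: summable_cmult_iff)
  then have r_less: "r < 1"
    using r_nonneg by (simp add: summable_geometric_iff)
  then have c_half: "1 / 2 < c"
    using c_pos by (simp add: r_def field_simps)
  have "(\<lambda>k. h 0 * r ^ k) sums (h 0 * (1 / (1 - r)))"
    using r_nonneg r_less by (intro sums_mult geometric_sums) simp
  then have "h 0 * (1 / (1 - r)) = 1"
    using h_sums h_fun sums_unique2 by metis
  then have h0_eq: "h 0 = 1 - r"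
    using r_less by (simp add: field_simps)
  have g_eq: "g n w = cylinder_mass c n w" if w: "1 \<le> w" for n w
  proof -
    have "g 0 w = h (w - 1)"
      using w by (simp add: h_def)
    also have "\<dots> = (1 - r) * r ^ (w - 1)"
      using h_power[of "w - 1"] unfolding h0_eq .
    finally have "g n w = c ^ n * ((1 - r) * r ^ (w - 1))"
      using power[OF w, of n] by simp
    then show ?thesis
      unfolding cylinder_mass_def r_def[symmetric] by simp
  qed
  have "c < 1"
  proof (rule ccontr)
    assume "\<not> c < 1"
    with c have "c = 1"
      by simp
    then have "g n 1 = 1" for n
      using g_eq[of 1 n] by (simp add: cylinder_mass_def)
    with nonatomic_vertical_cylinder[OF M(1,2) nonat, of 1] show False
      by (simp add: g_def)
  qed
  have "M = geometric_bernoulli c"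
  proof (rule path_measure_eqI[where n = 0])
    fix v es w assume es: "finite_path v es w"
    have "measure M (cylinder v es) = cylinder_mass c (length es) w"
      using measure_cylinder_vertical[OF M(1) finite_measure_axioms M(3) es]
        g_eq[OF finite_path_range_ge1[OF es]] by (simp add: g_def)
    then show "emeasure M (cylinder v es) = emeasure (geometric_bernoulli c) (cylinder v es)"
      unfolding emeasure_geometric_bernoulli[OF c_half \<open>c < 1\<close> es] by (simp add: emeasure_eq_measure)
  qed (simp_all add: M)
  with c_half \<open>c < 1\<close> show ?thesis
    by blast
qed

theorem theorem5p3:
  fixes i :: nat
  assumes "1 \<le> i"
  shows "{normalized (nu_hat i p) | p :: real. 1 / 2 < p \<and> p < 1} = ergodic_invariant_probs"
proof -
  have "{normalized (nu_hat i p) | p :: real. 1 / 2 < p \<and> p < 1}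
      = {geometric_bernoulli p | p :: real. 1 / 2 < p \<and> p < 1}"
    using normalized_nu_hat[OF assms] by force
  also have "\<dots> = ergodic_invariant_probs"
    using geometric_bernoulli_ergodic_invariant ergodic_invariant_is_geometric_bernoulli by blast
  finally show ?thesis .
qed

end
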